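(* There is an absolute constant $C>0$ such that the following holds. Let $\mathbf{P}$ be a symmetric coset progression of rank $d\ge 0$ in an additive group $G$, and let $t\ge 1$ be real. Then there exists a $t$-proper symmetric coset progression $\mathbf{Q}$ in $G$ of rank at most $d$ such that $$\operatorname{Image}(\mathbf{P}_{t'})\subseteq \operatorname{Image}\big(\mathbf{Q}_{(Cd)^{3d/2}tt'}\big)\quad\text{for all } t'>0,$$ $$\operatorname{Image}(\mathbf{Q}_{tt'})\subseteq \operatorname{Image}(\mathbf{P}_{t'})\quad\text{for all } t'\ge 1.$$ In particular, $\operatorname{Image}(\mathbf{Q})\subseteq\operatorname{Image}(\mathbf{P})\subseteq\operatorname{Image}\big(\mathbf{Q}_{(Cd)^{3d/2}t}\big)$. Furthermore, $$t^{-d}\,2^{-d^2-Cd\log(d+1)}\operatorname{size}(\mathbf{P})\le\operatorname{size}(\mathbf{Q})\le\operatorname{size}(\mathbf{P}).$$ Finally, the symmetry group of $\mathbf{Q}$ contains that of $\mathbf{P}$, and if $\mathbf{P}$ is not $1/2$-proper, then $\mathbf{Q}$ can be chosen to have rank at most $d-1$ while still being a $t$-proper symmetric coset progression in $G$ whose symmetry group contains that of $\mathbf{P}$ and which satisfies $\operatorname{Image}(\mathbf{P}_{t'})\subseteq \operatorname{Image}\big(\mathbf{Q}_{(Cd)^{3d/2}tt'}\big)$ for all $t'>0$, $\operatorname{Image}(\mathbf{Q}_{tt'})\subseteq \operatorname{Image}(\mathbf{P}_{t'})$ for all $t'\ge 1$, and $t^{-d}\,2^{-d^2-Cd\log(d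+1)}\operatorname{size}(\mathbf{P})\le\operatorname{size}(\mathbf{Q})\le\operatorname{size}(\mathbf{P})$.
   Context: An additive group is an abelian group written additively. A symmetric coset progression in $G$ is a quadruple $\mathbf{P}=(N,v,d,H)$, where $d=\operatorname{rank}(\mathbf{P})\ge 0$ is an integer, $N=(N_1,\dots,N_d)$ is a tuple of positive reals (the dimensions), $v=(v_1,\dots,v_d)$ is a tuple of elements of $G$ (the steps), and $H$ is a finite subgroup of $G$ (the symmetry group). Its image is $\operatorname{Image}(\mathbf{P}):=\{h+\sum_{i=1}^d n_iv_i: h\in H,\ n_i\in\mathbb{Z},\ |n_i|\le N_i\}\subseteq G$, and its size is $\operatorname{size}(\mathbf{P}):=|\operatorname{Image}(\mathbf{P})|$. For real $t>0$ the dilate is $\mathbf{P}_t:=(tN,v,d,H)$. $\mathbf{P}$ is proper if the elements $h+\sum_i n_iv_i$, for $h\in H$ and integers $n_i$ with $|n_i|\le N_i$, are all distinct; it is $t$-proper if $\mathbf{P}_t$ is proper. Convention: $0^0=1$. *)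

theory Defs
  imports Complex_Main "HOL-Algebra.Algebra"
begin

text \<open>
  Abelian groups are the HOL-Algebra locale \<open>comm_group\<close>, hence written multiplicatively: the sum
  \<open>h + n\<^sub>1 v\<^sub>1 + ... + n\<^sub>d v\<^sub>d\<close> appears as a product of powers. Indices run over \<open>{..<d}\<close>;
  values of the dimension and step functions outside this range are irrelevant.
\<close>

record 'a coset_progression =
  dims :: "nat \<Rightarrow> real"
  steps :: "nat \<Rightarrow> 'a"
  cp_rank :: nat
  sym_group :: "'a set"

definition symmetric_coset_progression ::
    "('a, 'b) monoid_scheme \<Rightarrow> 'a coset_progression \<Rightarrow> bool" where
  "symmetric_coset_progression G P \<longleftrightarrow>
     (\<forall>i<cp_rank P. 0 < dims P i \<and> steps P i \<in> carrier G) \<and>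
     subgroup (sym_group P) G \<and> finite (sym_group P)"

definition coefficient_box :: "'a coset_progression \<Rightarrow> (nat \<Rightarrow> int) set" where
  "coefficient_box P = (\<Pi>\<^sub>E i\<in>{..<cp_rank P}. {k. \<bar>real_of_int k\<bar> \<le> dims P i})"

definition cp_element ::
    "('a, 'b) monoid_scheme \<Rightarrow> 'a coset_progression \<Rightarrow> 'a \<Rightarrow> (nat \<Rightarrow> int) \<Rightarrow> 'a" where
  "cp_element G P h n = h \<otimes>\<^bsub>G\<^esub> (\<Otimes>\<^bsub>G\<^esub>i\<in>{..<cp_rank P}. steps P i [^]\<^bsub>G\<^esub> n i)"

definition cp_image :: "('a, 'b) monoid_scheme \<Rightarrow> 'a coset_progression \<Rightarrow> 'a set" where
  "cp_image G P = {cp_element G P h n | h n. h \<in> sym_group P \<and> n \<in> coefficient_box P}"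

definition cp_size :: "('a, 'b) monoid_scheme \<Rightarrow> 'a coset_progression \<Rightarrow> nat" where
  "cp_size G P = card (cp_image G P)"

definition dilate :: "real \<Rightarrow> 'a coset_progression \<Rightarrow> 'a coset_progression" where
  "dilate t P = P\<lparr>dims := (\<lambda>i. t * dims P i)\<rparr>"

definition proper :: "('a, 'b) monoid_scheme \<Rightarrow> 'a coset_progression \<Rightarrow> bool" where
  "proper G P \<longleftrightarrow>
     inj_on (\<lambda>(h, n). cp_element G P h n) (sym_group P \<times> coefficient_box P)"

definition t_proper :: "('a, 'b) monoid_scheme \<Rightarrow> real \<Rightarrow> 'a coset_progression \<Rightarrow> bool" where
  "t_proper G t P \<longleftrightarrow> proper G (dilate t P)"

text \<open>
  The factor \<open>(C d)\<close> to the power \<open>3 d / 2\<close>. The case \<open>d = 0\<close> implements the convention that zero to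
  the power zero is one, whereas \<open>0 powr 0 = 0\<close>.
\<close>

definition expansion_factor :: "real \<Rightarrow> nat \<Rightarrow> real" where
  "expansion_factor C d = (if d = 0 then 1 else (C * real d) powr (3 * real d / 2))"

definition proper_approximation ::
    "('a, 'b) monoid_scheme \<Rightarrow> real \<Rightarrow> real \<Rightarrow> 'a coset_progression \<Rightarrow> 'a coset_progression \<Rightarrow> bool"
  where
  "proper_approximation G C t P Q \<longleftrightarrow>
     symmetric_coset_progression G Q \<and>
     t_proper G t Q \<and>
     sym_group P \<subseteq> sym_group Q \<and>
     (\<forall>t'>0. cp_image G (dilate t' P) \<subseteq>
               cp_image G (dilate (expansion_factor C (cp_rank P) * t * t') Q)) \<and>
     (\<forall>t'\<ge>1. cp_image G (dilate (t * t') Q) \<subseteq> cp_image G (dilate t' P)) \<and>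
     t powr (- real (cp_rank P)) *
         2 powr (- (real (cp_rank P))\<^sup>2 - C * real (cp_rank P) * ln (real (cp_rank P) + 1)) *
         real (cp_size G P) \<le> real (cp_size G Q) \<and>
     cp_size G Q \<le> cp_size G P"

text \<open>
  HOL has no quantification over types inside a formula, so a formula of the shape ``there is \<open>C\<close>
  such that for all groups on \<open>'a\<close>'' would let \<open>C\<close> depend on the type \<open>'a\<close>. An absolute constant has
  to be a closed term of type \<open>real\<close> not involving \<open>'a\<close>. We pick one that works for all groups
  carried by a set of natural numbers, that is, up to isomorphism, for all countable abelian groups.
  Nothing is assumed about other groups or about the existence of such a constant: both are part of
  what a theorem about \<open>absolute_constant\<close> and an arbitrary \<open>'a\<close> has to establish. (The choice is
  adequate because one may pass to the countable subgroup generated by the progression.)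
\<close>

definition absolute_constant :: real where
  "absolute_constant = (SOME C. C > 0 \<and>
     (\<forall>(G :: nat monoid) P t.
        comm_group G \<and> symmetric_coset_progression G P \<and> t \<ge> 1 \<longrightarrow>
        (\<exists>Q. proper_approximation G C t P Q \<and> cp_rank Q \<le> cp_rank P) \<and>
        (\<not> t_proper G (1/2) P \<longrightarrow>
           (\<exists>Q. proper_approximation G C t P Q \<and> cp_rank Q < cp_rank P))))"

end

theory Submission
  imports Defs "HOL-Analysis.Inner_Product" "HOL-Library.Countable_Set"
begin

text \<open>
  Scaling the coordinates by the dimensions turns $\mathbf{P}$ into a subgroup $R$ of
  $E \times G$, where $E$ is a Euclidean space: it consists of the pairs of a coefficient vector
  and the group element that it represents. Only finitely many elements of $R$ lie over each ball
  of $E$. A nontrivial relation is an element $(x, 1)$ of $R$ with $x \ne 0$. Projecting $E$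
  orthogonally along $x$ lowers the rank by one and moves the torsion created by $x$ into the fibre
  of $R$ over $0$, which will be the symmetry group of $\mathbf{Q}$. Every element of the projection
  lifts modulo $x$ with the squared norm growing by at most $|x|^2/4$. So all relations of norm at
  most $\delta \approx 1/d$ can be removed, one after the other, at a total cost of $d\delta^2/4$.
  If $\mathbf{P}$ is not $1/2$-proper, there is a relation with all coordinates at most $1$. It is
  removed first: lifting along it costs at most $1/2$ in the supremum norm.

  The lattice of first components of the remaining relation-free $R$ is given a reduced basis $w$:
  a shortest vector followed by size-reduced lifts of a reduced basis of the orthogonal projection.
  The progression $\mathbf{Q}$ has steps lying over the $w_i$ and dimensions proportional to
  $1/|w_i|$.

  The constant $32$ works for all groups. To treat \<^const>\<open>absolute_constant\<close>, which is only known to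
  work for groups on the natural numbers, one passes to the countable subgroup generated by
  $\mathbf{P}$.
\<close>

subsection \<open>A space containing every Euclidean space\<close>

text \<open>The Euclidean dimension is the rank of \<open>P\<close>, a term and not a type. Finitely
  supported sequences form a single inner product space that has room for every rank.\<close>

typedef fin_seq = "{f :: nat \<Rightarrow> real. finite {i. f i \<noteq> 0}}"
  morphisms coord Fin_Seq
  by (rule exI[of _ "\<lambda>_. 0"]) simp

lemma finite_coord: "finite {i. coord x i \<noteq> 0}"
  using coord[of x] by simp

lemma fin_seq_eqI: "(\<And>i. coord x i = coord y i) \<Longrightarrow> x = y"
  using coord_inject[of x y] by (simp add: fun_eq_iff)

instantiation fin_seq :: real_vector
begin

definition "0 = Fin_Seq (\<lambda>_. 0)"
definition "x + y = Fin_Seq (\<lambda>i. coord x i + coord y i)"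
definition "x - y = Fin_Seq (\<lambda>i. coord x i - coord y i)"
definition "- x = Fin_Seq (\<lambda>i. - coord x i)"
definition "r *\<^sub>R x = Fin_Seq (\<lambda>i. r * coord x i)"

lemma coord_zero [simp]: "coord 0 i = 0"
  by (simp add: zero_fin_seq_def Fin_Seq_inverse)

lemma coord_add [simp]: "coord (x + y) i = coord x i + coord y i"
proof -
  have "{i. coord x i + coord y i \<noteq> 0} \<subseteq> {i. coord x i \<noteq> 0} \<union> {i. coord y i \<noteq> 0}"
    by auto
  then have "finite {i. coord x i + coord y i \<noteq> 0}"
    using finite_coord[of x] finite_coord[of y] finite_subset by blast
  then show ?thesis
    by (simp add: plus_fin_seq_def Fin_Seq_inverse)
qed

lemma coord_diff [simp]: "coord (x - y) i = coord x i - coord y i"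
proof -
  have "{i. coord x i - coord y i \<noteq> 0} \<subseteq> {i. coord x i \<noteq> 0} \<union> {i. coord y i \<noteq> 0}"
    by auto
  then have "finite {i. coord x i - coord y i \<noteq> 0}"
    using finite_coord[of x] finite_coord[of y] finite_subset by blast
  then show ?thesis
    by (simp add: minus_fin_seq_def Fin_Seq_inverse)
qed

lemma coord_uminus [simp]: "coord (- x) i = - coord x i"
  using finite_coord[of x] by (simp add: uminus_fin_seq_def Fin_Seq_inverse)

lemma coord_scaleR [simp]: "coord (r *\<^sub>R x) i = r * coord x i"
proof -
  have "{i. r * coord x i \<noteq> 0} \<subseteq> {i. coord x i \<noteq> 0}"
    by auto
  then have "finite {i. r * coord x i \<noteq> 0}"
    using finite_coord[of x] finite_subset by blast
  then show ?thesis
    by (simp add: scaleR_fin_seq_def Fin_Seq_inverse)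
qed

instance
  by standard (auto intro!: fin_seq_eqI simp: algebra_simps)

end

instantiation fin_seq :: real_inner
begin

definition "inner x y = (\<Sum>i | coord x i \<noteq> 0. coord x i * coord y i)"
definition "norm (x :: fin_seq) = sqrt (inner x x)"
definition "sgn (x :: fin_seq) = x /\<^sub>R norm x"
definition "dist (x :: fin_seq) y = norm (x - y)"
definition "(uniformity :: (fin_seq \<times> fin_seq) filter) =
  (INF e\<in>{0<..}. principal {(x, y). dist x y < e})"
definition "open (U :: fin_seq set) \<longleftrightarrow>
  (\<forall>x\<in>U. eventually (\<lambda>(x', y). x' = x \<longrightarrow> y \<in> U) uniformity)"

text \<open>The defining sum runs over the support of the first argument, which hides symmetry and
  additivity. Over a common finite superset of the supports the inner product axioms become
  identities of finite sums.\<close>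

lemma inner_fin_seq_superset:
  assumes "finite S" "{i. coord x i \<noteq> 0} \<subseteq> S"
  shows "inner x y = (\<Sum>i\<in>S. coord x i * coord y i)"
  unfolding inner_fin_seq_def using assms by (intro sum.mono_neutral_left) auto

instance
proof
  fix x y z :: fin_seq and r :: real
  let ?S = "{i. coord x i \<noteq> 0} \<union> {i. coord y i \<noteq> 0}"
  have fin: "finite ?S"
    using finite_coord by blast
  show "inner x y = inner y x"
    using fin by (simp add: inner_fin_seq_superset[of ?S] mult.commute)
  show "inner (x + y) z = inner x z + inner y z"
    using fin by (subst (1 2 3) inner_fin_seq_superset[of ?S])
      (auto simp: sum.distrib distrib_right)
  show "inner (r *\<^sub>R x) y = r * inner x y"
    using fin by (subst (1 2) inner_fin_seq_superset[of ?S])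
      (auto simp: sum_distrib_left mult.assoc)
  show "0 \<le> inner x x"
    unfolding inner_fin_seq_def by (intro sum_nonneg) auto
  show "inner x x = 0 \<longleftrightarrow> x = 0"
    unfolding inner_fin_seq_def using finite_coord[of x]
    by (subst sum_nonneg_eq_0_iff) (auto intro: fin_seq_eqI)
qed (simp_all add: norm_fin_seq_def sgn_fin_seq_def dist_fin_seq_def
      uniformity_fin_seq_def open_fin_seq_def)

end

definition std_basis :: "nat \<Rightarrow> fin_seq" where
  "std_basis i = Fin_Seq (\<lambda>j. if j = i then 1 else 0)"

lemma coord_std_basis [simp]: "coord (std_basis i) j = (if j = i then 1 else 0)"
  by (simp add: std_basis_def Fin_Seq_inverse)

lemma inner_std_basis: "inner x (std_basis i) = coord x i"
proof -
  have "inner (std_basis i) x = (\<Sum>j\<in>{i}. coord (std_basis i) j * coord x j)"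
    by (intro inner_fin_seq_superset) auto
  then show ?thesis
    by (simp add: inner_commute)
qed

lemma norm_std_basis [simp]: "norm (std_basis i) = 1"
  by (simp add: norm_eq_sqrt_inner inner_std_basis)

lemma abs_coord_le_norm: "\<bar>coord x i\<bar> \<le> norm x"
  using Cauchy_Schwarz_ineq2[of x "std_basis i"] by (simp add: inner_std_basis)

lemma coord_sum: "coord (sum f A) i = (\<Sum>a\<in>A. coord (f a) i)"
  by (induction A rule: infinite_finite_induct) auto

subsection \<open>Projections and discrete subgroups\<close>

text \<open>The coordinate of \<open>x\<close> along \<open>b\<close> in its decomposition into a
  multiple of \<open>b\<close> and a vector orthogonal to \<open>b\<close>. For \<open>b = 0\<close>
  the division yields 0, so that \<open>proj_away 0\<close> is the identity.\<close>

definition proj_coeff :: "'e::real_inner \<Rightarrow> 'e \<Rightarrow> real" where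
  "proj_coeff b x = inner x b / inner b b"

definition proj_away :: "'e::real_inner \<Rightarrow> 'e \<Rightarrow> 'e" where
  "proj_away b x = x - proj_coeff b x *\<^sub>R b"

lemma proj_away_decomp: "x = proj_away b x + proj_coeff b x *\<^sub>R b"
  by (simp add: proj_away_def)

lemma proj_coeff_diff: "proj_coeff b (x - y) = proj_coeff b x - proj_coeff b y"
  by (simp add: proj_coeff_def inner_diff_left diff_divide_distrib)

lemma proj_coeff_add: "proj_coeff b (x + y) = proj_coeff b x + proj_coeff b y"
  by (simp add: proj_coeff_def inner_add_left add_divide_distrib)

lemma proj_coeff_scaleR: "proj_coeff b (r *\<^sub>R x) = r * proj_coeff b x"
  by (simp add: proj_coeff_def)

lemma proj_coeff_sum: "proj_coeff b (sum f A) = (\<Sum>a\<in>A. proj_coeff b (f a))"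
  by (simp add: proj_coeff_def inner_sum_left sum_divide_distrib)

lemma proj_coeff_self: "b \<noteq> 0 \<Longrightarrow> proj_coeff b b = 1"
  by (simp add: proj_coeff_def)

lemma linear_proj_away: "linear (proj_away b)"
  by (rule linearI) (simp_all add: proj_away_def proj_coeff_add proj_coeff_scaleR algebra_simps)

lemma proj_away_self [simp]: "proj_away b b = 0"
  by (cases "b = 0") (simp_all add: proj_away_def proj_coeff_self)

lemma proj_away_zero [simp]: "proj_away b 0 = 0"
  by (simp add: linear_0 linear_proj_away)

section \<open>Pythagoras and size reduction\<close>

lemma norm_add_orthogonal:
  fixes u v :: "'e::real_inner"
  assumes "inner u v = 0"
  shows "(norm (u + v))\<^sup>2 = (norm u)\<^sup>2 + (norm v)\<^sup>2"
  using assms by (simp add: power2_norm_eq_inner inner_add_left inner_add_right inner_commute)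

lemma norm_proj_away_sq:
  "(norm x)\<^sup>2 = (norm (proj_away b x))\<^sup>2 + (proj_coeff b x * norm b)\<^sup>2"
proof (cases "b = 0")
  case False
  have "inner (proj_away b x) b = 0"
    using False by (simp add: proj_away_def proj_coeff_def inner_diff_left)
  then have orth: "inner (proj_away b x) (proj_coeff b x *\<^sub>R b) = 0"
    by simp
  have "(norm x)\<^sup>2 = (norm (proj_away b x + proj_coeff b x *\<^sub>R b))\<^sup>2"
    by (simp flip: proj_away_decomp)
  also have "\<dots> = (norm (proj_away b x))\<^sup>2 + (norm (proj_coeff b x *\<^sub>R b))\<^sup>2"
    by (rule norm_add_orthogonal[OF orth])
  finally show ?thesis
    by (simp add: power_mult_distrib)
qed (simp add: proj_away_def)

lemma norm_proj_away_le: "norm (proj_away b x) \<le> norm x"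
  by (rule power2_le_imp_le) (simp_all add: norm_proj_away_sq[of x b])

lemma abs_proj_coeff_le: "\<bar>proj_coeff b x\<bar> * norm b \<le> norm x"
proof -
  have "(\<bar>proj_coeff b x\<bar> * norm b)\<^sup>2 \<le> (norm x)\<^sup>2"
    by (simp add: norm_proj_away_sq[of x b] power_mult_distrib)
  then show ?thesis
    by (rule power2_le_imp_le) simp
qed

lemma proj_away_shift [simp]: "proj_away b (x - k *\<^sub>R b) = proj_away b x"
  by (simp add: linear_diff[OF linear_proj_away] linear_scale[OF linear_proj_away])

text \<open>Size reduction: \<open>k\<close> is the integer nearest to the coefficient of
  \<open>x\<close> along \<open>b\<close>.\<close>

lemma reduce_modulo:
  obtains k :: int where "\<bar>proj_coeff b (x - of_int k *\<^sub>R b)\<bar> \<le> 1/2"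
proof (cases "b = 0")
  case False
  have "\<bar>proj_coeff b (x - of_int (round (proj_coeff b x)) *\<^sub>R b)\<bar> \<le> 1/2"
    using of_int_round_abs_le[of "proj_coeff b x"] False
    by (simp add: proj_coeff_diff proj_coeff_scaleR proj_coeff_self abs_minus_commute)
  then show ?thesis
    using that by blast
qed (use that in \<open>simp add: proj_coeff_def\<close>)

text \<open>By Pythagoras, a coefficient of at most 1/2 costs at most a quarter of the squared
  length of \<open>b\<close>. Squared costs simply add up over successive projections.\<close>

lemma norm_reduced_sq:
  assumes "\<bar>proj_coeff b x\<bar> \<le> 1/2"
  shows "(norm x)\<^sup>2 \<le> (norm (proj_away b x))\<^sup>2 + (norm b)\<^sup>2 / 4"
proof -
  have "(proj_coeff b x)\<^sup>2 \<le> (1/2)\<^sup>2"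
    using assms abs_le_square_iff[of "proj_coeff b x" "1/2"] by simp
  then have "(proj_coeff b x)\<^sup>2 * (norm b)\<^sup>2 \<le> (1/4) * (norm b)\<^sup>2"
    by (intro mult_right_mono) (simp_all add: power2_eq_square)
  then show ?thesis
    by (simp add: norm_proj_away_sq[of x b] power_mult_distrib)
qed

lemma norm_reduced_le:
  assumes "\<bar>proj_coeff b x\<bar> \<le> 1/2"
  shows "norm x \<le> norm (proj_away b x) + norm b / 2"
proof (rule power2_le_imp_le)
  have "(norm x)\<^sup>2 \<le> (norm (proj_away b x))\<^sup>2 + (norm b / 2)\<^sup>2"
    using norm_reduced_sq[OF assms] by (simp add: power_divide)
  also have "\<dots> \<le> (norm (proj_away b x) + norm b / 2)\<^sup>2"
    by (simp add: power2_sum)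
  finally show "(norm x)\<^sup>2 \<le> (norm (proj_away b x) + norm b / 2)\<^sup>2" .
qed simp

text \<open>A bound for the dimension of the real span of \<open>L\<close>, witnessed by a spanning
  set that may be dependent and may lie outside \<open>L\<close>.\<close>

definition rank_at_most :: "nat \<Rightarrow> 'e::real_vector set \<Rightarrow> bool" where
  "rank_at_most r L \<longleftrightarrow> (\<exists>B. finite B \<and> card B \<le> r \<and> L \<subseteq> span B)"

lemma rank_at_most_0: "rank_at_most 0 L \<Longrightarrow> L \<subseteq> {0}"
  by (auto simp: rank_at_most_def)

text \<open>Steinitz exchange: \<open>x\<close> can replace some generator \<open>c\<close>. When
  \<open>a\<close> joins \<open>B\<close>, either \<open>x\<close> already lies in the span of
  \<open>B\<close> and induction applies, or \<open>x\<close> involves \<open>a\<close> with a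
  nonzero coefficient and \<open>a\<close> itself is replaced.\<close>

lemma span_exchange:
  assumes "finite B" "x \<in> span B" "x \<noteq> 0"
  shows "\<exists>c\<in>B. c \<in> span (insert x (B - {c}))"
  using assms
proof (induction B rule: finite_induct)
  case (insert a B)
  show ?case
  proof (cases "x \<in> span B")
    case True
    then obtain c where c: "c \<in> B" "c \<in> span (insert x (B - {c}))"
      using insert by blast
    have "insert x (B - {c}) \<subseteq> insert x (insert a B - {c})"
      by blast
    from span_mono[OF this] have "c \<in> span (insert x (insert a B - {c}))"
      using c(2) by (rule subsetD)
    then show ?thesis
      using c(1) by (intro bexI[of _ c]) simp_all
  next
    case False
    with insert.prems(1) have "a \<in> span (insert x B)"
      by (rule in_span_insert)
    moreover have "insert a B - {a} = B"
      using insert.hyps by simp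
    ultimately show ?thesis
      by (intro bexI[of _ a]) simp_all
  qed
qed simp

text \<open>Exchange one generator for \<open>b\<close>. The projection kills \<open>b\<close>, so
  the images of the remaining generators span the projection of \<open>L\<close>.\<close>

lemma rank_at_most_proj_away:
  assumes "rank_at_most r L" "b \<in> L" "b \<noteq> 0"
  shows "0 < r" "rank_at_most (r - 1) (proj_away b ` L)"
proof -
  obtain B where B: "finite B" "card B \<le> r" "L \<subseteq> span B"
    using assms(1) by (auto simp: rank_at_most_def)
  have "b \<in> span B"
    using B assms by auto
  from span_exchange[OF B(1) this assms(3)]
  obtain c where c: "c \<in> B" and cs: "c \<in> span (insert b (B - {c}))"
    by (elim bexE)
  have "B \<subseteq> span (insert b (B - {c}))"
    using cs span_superset[of "insert b (B - {c})"] by auto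
  then have "L \<subseteq> span (insert b (B - {c}))"
    using B(3) span_minimal[OF _ subspace_span] by blast
  then have "proj_away b ` L \<subseteq> span (proj_away b ` insert b (B - {c}))"
    unfolding linear_span_image[OF linear_proj_away] by (rule image_mono)
  then have *: "proj_away b ` L \<subseteq> span (proj_away b ` (B - {c}))"
    by simp
  have "card (proj_away b ` (B - {c})) \<le> card (B - {c})"
    using B(1) by (intro card_image_le) auto
  also have "\<dots> \<le> r - 1"
    using B(1,2) c by simp
  finally show "rank_at_most (r - 1) (proj_away b ` L)"
    unfolding rank_at_most_def using * B(1) by (intro exI[of _ "proj_away b ` (B - {c})"]) simp
  have "0 < card B"
    using B(1) c by (auto simp: card_gt_0_iff)
  then show "0 < r"
    using B(2) by linarith
qed

lemma rank_at_most_mono: "rank_at_most r L \<Longrightarrow> r \<le> s \<Longrightarrow> rank_at_most s L"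
  by (auto simp: rank_at_most_def intro: order_trans)

text \<open>A lattice in its real span. Finiteness in every ball is required directly because the
  ambient space may have infinite dimension, where topological discreteness is weaker.\<close>

definition discrete_subgroup :: "'e::real_inner set \<Rightarrow> bool" where
  "discrete_subgroup L \<longleftrightarrow> 0 \<in> L \<and> (\<forall>x\<in>L. \<forall>y\<in>L. x - y \<in> L) \<and>
     (\<forall>\<rho>. finite {x \<in> L. norm x \<le> \<rho>})"

lemma discrete_subgroup_diff: "discrete_subgroup L \<Longrightarrow> x \<in> L \<Longrightarrow> y \<in> L \<Longrightarrow> x - y \<in> L"
  by (simp add: discrete_subgroup_def)

lemma discrete_subgroup_add:
  assumes "discrete_subgroup L" "x \<in> L" "y \<in> L" shows "x + y \<in> L"
proof -
  have "0 - y \<in> L"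
    using assms by (auto simp: discrete_subgroup_def)
  then have "x - (0 - y) \<in> L"
    using assms by (auto simp only: discrete_subgroup_def)
  then show ?thesis by simp
qed

lemma discrete_subgroup_scale:
  assumes "discrete_subgroup L" "x \<in> L"
  shows "of_int k *\<^sub>R x \<in> L"
proof (induction k rule: int_induct[of _ 0])
  case base
  then show ?case using assms by (simp add: discrete_subgroup_def)
next
  case (step1 i)
  then show ?case
    using discrete_subgroup_add[OF assms(1) _ assms(2)] by (simp add: scaleR_left_distrib)
next
  case (step2 i)
  then show ?case
    using discrete_subgroup_diff[OF assms(1) _ assms(2)] by (simp add: scaleR_left_diff_distrib)
qed

lemma reduced_lift:
  assumes "discrete_subgroup L" "b \<in> L" "x \<in> L"
  obtains y where "y \<in> L" "proj_away b y = proj_away b x" "\<bar>proj_coeff b y\<bar> \<le> 1/2"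
proof -
  obtain k :: int where "\<bar>proj_coeff b (x - of_int k *\<^sub>R b)\<bar> \<le> 1/2"
    by (rule reduce_modulo)
  then show ?thesis
    using that[of "x - of_int k *\<^sub>R b"] assms discrete_subgroup_diff discrete_subgroup_scale
    by (metis proj_away_shift)
qed

text \<open>A projected point of norm at most \<open>\<rho>\<close> has a reduced lift of norm at
  most \<open>\<rho> + norm b / 2\<close>, so a ball of the projection is covered by the image of a
  finite ball of \<open>L\<close>.\<close>

lemma discrete_subgroup_proj_away:
  assumes L: "discrete_subgroup L" and b: "b \<in> L"
  shows "discrete_subgroup (proj_away b ` L)"
  unfolding discrete_subgroup_def
proof (intro conjI ballI allI)
  show "0 \<in> proj_away b ` L"
    using L by (force simp: discrete_subgroup_def)
next
  fix x y assume "x \<in> proj_away b ` L" "y \<in> proj_away b ` L"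
  then show "x - y \<in> proj_away b ` L"
    using L by (auto simp: discrete_subgroup_def simp flip: linear_diff[OF linear_proj_away])
next
  fix \<rho>
  have "{x \<in> proj_away b ` L. norm x \<le> \<rho>} \<subseteq>
      proj_away b ` {x \<in> L. norm x \<le> \<rho> + norm b / 2}"
  proof clarify
    fix x assume "x \<in> L" "norm (proj_away b x) \<le> \<rho>"
    then show "proj_away b x \<in> proj_away b ` {x \<in> L. norm x \<le> \<rho> + norm b / 2}"
      using reduced_lift[OF L b] norm_reduced_le[of b]
      by (smt (verit, best) image_iff mem_Collect_eq)
  qed
  then show "finite {x \<in> proj_away b ` L. norm x \<le> \<rho>}"
    using L finite_surj unfolding discrete_subgroup_def by blast
qed

lemma shortest_vector:
  assumes L: "discrete_subgroup L" and ne: "\<not> L \<subseteq> {0}"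
  obtains b where "b \<in> L" "b \<noteq> 0" "\<And>x. x \<in> L \<Longrightarrow> x \<noteq> 0 \<Longrightarrow> norm b \<le> norm x"
proof -
  obtain x0 where x0: "x0 \<in> L" "x0 \<noteq> 0"
    using ne by auto
  let ?S = "{x \<in> L. norm x \<le> norm x0} - {0}"
  have "finite ?S" "?S \<noteq> {}"
    using L x0 by (auto simp: discrete_subgroup_def)
  then obtain b where b: "b \<in> ?S" "\<And>x. x \<in> ?S \<Longrightarrow> norm b \<le> norm x"
    using ex_min_if_finite[of "norm ` ?S"] by (smt (verit) arg_min_if_finite(1) arg_min_least)
  then show ?thesis
    using that[of b] x0 by (smt (verit) DiffE DiffI empty_iff insert_iff mem_Collect_eq)
qed

text \<open>Reducing \<open>x\<close> modulo \<open>b\<close> leaves a vector of \<open>L\<close> of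
  norm at most \<open>norm b / 2\<close>, which is 0 by minimality.\<close>

lemma shortest_vector_primitive:
  assumes L: "discrete_subgroup L" and b: "b \<in> L" "b \<noteq> 0"
    and min: "\<And>x. x \<in> L \<Longrightarrow> x \<noteq> 0 \<Longrightarrow> norm b \<le> norm x"
    and x: "x \<in> L" "proj_away b x = 0"
  obtains k :: int where "x = of_int k *\<^sub>R b"
proof -
  obtain k :: int where k: "\<bar>proj_coeff b (x - of_int k *\<^sub>R b)\<bar> \<le> 1/2"
    by (rule reduce_modulo)
  have "norm (x - of_int k *\<^sub>R b) \<le> norm b / 2"
    using norm_reduced_le[OF k] x(2) by simp
  moreover have "x - of_int k *\<^sub>R b \<in> L"
    using L b x discrete_subgroup_diff discrete_subgroup_scale by blast
  ultimately have "x - of_int k *\<^sub>R b = 0"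
    using min b(2) by (smt (verit) zero_less_norm_iff field_sum_of_halves)
  then show ?thesis
    using that[of k] by simp
qed

subsection \<open>Reduced bases\<close>

lemma card_int_interval_le:
  fixes A c :: real
  assumes "0 \<le> A"
  shows "finite {k :: int. \<bar>c + of_int k\<bar> \<le> A}" "real (card {k :: int. \<bar>c + of_int k\<bar> \<le> A}) \<le> 1 + 2 * A"
proof -
  have *: "{k :: int. \<bar>c + of_int k\<bar> \<le> A} = {\<lceil>- A - c\<rceil>..\<lfloor>A - c\<rfloor>}"
    by (auto simp: ceiling_le_iff le_floor_iff abs_le_iff)
  show "finite {k :: int. \<bar>c + of_int k\<bar> \<le> A}"
    by (simp add: *)
  have "real_of_int (\<lfloor>A - c\<rfloor> + 1 - \<lceil>- A - c\<rceil>) \<le> 1 + 2 * A"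
    using of_int_floor_le[of "A - c"] le_of_int_ceiling[of "- A - c"]
    unfolding of_int_diff of_int_add of_int_1 by linarith
  then show "real (card {k :: int. \<bar>c + of_int k\<bar> \<le> A}) \<le> 1 + 2 * A"
    unfolding * using assms by simp
qed

text \<open>Points of one fibre differ by integer multiples of \<open>b\<close>, and their
  coefficients along \<open>b\<close> lie in an interval of length
  \<open>2 * \<rho> / norm b\<close>.\<close>

lemma card_proj_away_fibre:
  assumes L: "discrete_subgroup L" and b: "b \<in> L" "b \<noteq> 0"
    and min: "\<And>x. x \<in> L \<Longrightarrow> x \<noteq> 0 \<Longrightarrow> norm b \<le> norm x"
    and "0 \<le> \<rho>"
  shows "real (card {x \<in> L. proj_away b x = y \<and> norm x \<le> \<rho>}) \<le> 1 + 2 * \<rho> / norm b"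
    (is "real (card ?S) \<le> _")
proof (cases "?S = {}")
  case True
  show ?thesis
    unfolding True using assms(5) by simp
next
  case False
  then obtain z where z: "z \<in> L" "proj_away b z = y"
    by auto
  let ?K = "{k :: int. \<bar>proj_coeff b z + of_int k\<bar> \<le> \<rho> / norm b}"
  have \<rho>: "0 \<le> \<rho> / norm b"
    using assms by simp
  have "?S \<subseteq> (\<lambda>k. z + of_int k *\<^sub>R b) ` ?K"
  proof clarify
    fix x assume x: "x \<in> L" "norm x \<le> \<rho>" "y = proj_away b x"
    have "proj_away b (x - z) = 0"
      using x z by (simp add: linear_diff[OF linear_proj_away])
    moreover have "x - z \<in> L"
      using L x z discrete_subgroup_diff by blast
    ultimately obtain k :: int where k: "x - z = of_int k *\<^sub>R b"
      using shortest_vector_primitive[OF L b min] by metis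
    then have xk: "x = z + of_int k *\<^sub>R b"
      by (simp add: algebra_simps)
    have "proj_coeff b x = proj_coeff b z + of_int k"
      using b by (simp add: xk proj_coeff_add proj_coeff_scaleR proj_coeff_self)
    moreover have "\<bar>proj_coeff b x\<bar> \<le> \<rho> / norm b"
      using abs_proj_coeff_le[of b x] x(2) b by (simp add: field_simps)
    ultimately show "x \<in> (\<lambda>k. z + of_int k *\<^sub>R b) ` ?K"
      using xk by auto
  qed
  then have "card ?S \<le> card ?K"
    using card_int_interval_le(1)[OF \<rho>] by (rule surj_card_le[rotated])
  then show ?thesis
    using card_int_interval_le(2)[OF \<rho>, of "proj_coeff b z"] by simp
qed

text \<open>Projection does not increase norms, so the ball of \<open>L\<close> maps into the ball
  of the projection; each fibre is bounded by \<open>card_proj_away_fibre\<close>.\<close>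

lemma card_ball_proj_away:
  assumes L: "discrete_subgroup L" and b: "b \<in> L" "b \<noteq> 0"
    and min: "\<And>x. x \<in> L \<Longrightarrow> x \<noteq> 0 \<Longrightarrow> norm b \<le> norm x"
    and "0 \<le> \<rho>"
  shows "real (card {x \<in> L. norm x \<le> \<rho>}) \<le>
    real (card {y \<in> proj_away b ` L. norm y \<le> \<rho>}) * (1 + 2 * \<rho> / norm b)"
proof -
  let ?Y = "{y \<in> proj_away b ` L. norm y \<le> \<rho>}"
  let ?F = "\<lambda>y. {x \<in> L. proj_away b x = y \<and> norm x \<le> \<rho>}"
  have fin: "finite ?Y"
    using discrete_subgroup_proj_away[OF L b(1)] by (simp add: discrete_subgroup_def)
  have "norm (proj_away b x) \<le> \<rho>" if "norm x \<le> \<rho>" for x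
    using norm_proj_away_le that by (rule order_trans)
  then have "{x \<in> L. norm x \<le> \<rho>} = (\<Union>y\<in>?Y. ?F y)"
    by auto
  then have "card {x \<in> L. norm x \<le> \<rho>} \<le> (\<Sum>y\<in>?Y. card (?F y))"
    using card_UN_le[OF fin, of ?F] by presburger
  then have "real (card {x \<in> L. norm x \<le> \<rho>}) \<le> (\<Sum>y\<in>?Y. real (card (?F y)))"
    by (simp only: of_nat_sum[symmetric] of_nat_le_iff)
  also have "\<dots> \<le> (\<Sum>y\<in>?Y. 1 + 2 * \<rho> / norm b)"
    by (intro sum_mono card_proj_away_fibre assms)
  finally show ?thesis
    by simp
qed

text \<open>The third clause is quantitative independence: no coefficient can be large when the sum
  is short. The fourth replaces the second theorem of Minkowski by an upper bound for lattice points
  in balls. The factor \<open>fact s\<close> goes into the expansion factor, and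
  \<open>2 ^ s\<^sup>2\<close> into the loss of size.\<close>

definition reduced_basis :: "'e::real_inner set \<Rightarrow> nat \<Rightarrow> (nat \<Rightarrow> 'e) \<Rightarrow> bool" where
  "reduced_basis L s w \<longleftrightarrow>
     (\<forall>i<s. w i \<in> L \<and> w i \<noteq> 0) \<and>
     (\<forall>x\<in>L. \<exists>n :: nat \<Rightarrow> int. x = (\<Sum>i<s. of_int (n i) *\<^sub>R w i)) \<and>
     (\<forall>(n :: nat \<Rightarrow> int) i. i < s \<longrightarrow>
        \<bar>of_int (n i)\<bar> * norm (w i) \<le> fact s * norm (\<Sum>j<s. of_int (n j) *\<^sub>R w j)) \<and>
     (\<forall>\<rho>\<ge>0. real (card {x \<in> L. norm x \<le> \<rho>}) \<le> 2 ^ s\<^sup>2 * (\<Prod>i<s. 1 + 2 * \<rho> / norm (w i)))"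

text \<open>The new basis is \<open>b\<close> followed by reduced lifts \<open>u i\<close> of the
  \<open>w' i\<close>. The induction works because both \<open>norm b\<close> and
  \<open>norm (u i)\<close> are at most \<open>2 * norm (w' i)\<close>.\<close>

lemma reduced_basis_step:
  assumes L: "discrete_subgroup L" and b: "b \<in> L" "b \<noteq> 0"
    and min: "\<And>x. x \<in> L \<Longrightarrow> x \<noteq> 0 \<Longrightarrow> norm b \<le> norm x"
    and w': "reduced_basis (proj_away b ` L) s w'"
  shows "\<exists>w. reduced_basis L (Suc s) w"
proof -
  have w'_in: "w' i \<in> proj_away b ` L" and w'0: "w' i \<noteq> 0" if "i < s" for i
    using w' that unfolding reduced_basis_def by blast+
  have w'_span: "\<exists>n :: nat \<Rightarrow> int. x = (\<Sum>i<s. of_int (n i) *\<^sub>R w' i)"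
    if "x \<in> proj_away b ` L" for x
    using w' that unfolding reduced_basis_def by blast
  have w'_bound: "\<bar>of_int (n i)\<bar> * norm (w' i) \<le> fact s * norm (\<Sum>j<s. of_int (n j) *\<^sub>R w' j)"
    if "i < s" for n :: "nat \<Rightarrow> int" and i
    using w' that unfolding reduced_basis_def by blast
  have w'_card: "real (card {x \<in> proj_away b ` L. norm x \<le> \<rho>}) \<le>
      2 ^ s\<^sup>2 * (\<Prod>i<s. 1 + 2 * \<rho> / norm (w' i))" if "0 \<le> \<rho>" for \<rho>
    using w' that unfolding reduced_basis_def by blast
  have "\<exists>y. y \<in> L \<and> proj_away b y = w' i \<and> \<bar>proj_coeff b y\<bar> \<le> 1/2" if i: "i < s" for i
  proof -
    obtain x where "x \<in> L" "w' i = proj_away b x"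
      using w'_in[OF i] by blast
    then show ?thesis
      using reduced_lift[OF L b(1)] by metis
  qed
  then obtain u where u: "\<And>i. i < s \<Longrightarrow> u i \<in> L"
      "\<And>i. i < s \<Longrightarrow> proj_away b (u i) = w' i"
      "\<And>i. i < s \<Longrightarrow> \<bar>proj_coeff b (u i)\<bar> \<le> 1/2"
    by metis
  define w where "w = case_nat b u"
  have w_simps [simp]: "w 0 = b" "w (Suc i) = u i" for i
    by (simp_all add: w_def)
  have u0: "u i \<noteq> 0" if "i < s" for i
    using w'0[OF that] u(2)[OF that] by auto
  \<comment> \<open>Minimality gives \<open>norm b \<le> norm (u i)\<close>. Together with the
    estimate for reduced lifts this bounds both squares by 4/3 of the square of
    \<open>norm (w' i)\<close>; the cruder factor 4 suffices.\<close>
  have b_le: "norm b \<le> 2 * norm (w' i)" and u_le: "norm (u i) \<le> 2 * norm (w' i)" if "i < s" for i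
  proof -
    have 1: "(norm (u i))\<^sup>2 \<le> (norm (w' i))\<^sup>2 + (norm b)\<^sup>2 / 4"
      using norm_reduced_sq[OF u(3)] u(2) that by simp
    have "norm b \<le> norm (u i)"
      using min u(1) u0 that by blast
    then have 2: "(norm b)\<^sup>2 \<le> (norm (u i))\<^sup>2"
      by (intro power_mono) auto
    have 3: "(2 * norm (w' i))\<^sup>2 = 4 * (norm (w' i))\<^sup>2"
      by (simp add: power_mult_distrib)
    have 4: "0 \<le> (norm (w' i))\<^sup>2"
      by simp
    have "(norm b)\<^sup>2 \<le> (2 * norm (w' i))\<^sup>2"
      using 1 2 3 4 by linarith
    then show "norm b \<le> 2 * norm (w' i)"
      by (rule power2_le_imp_le) simp
    have "(norm (u i))\<^sup>2 \<le> (2 * norm (w' i))\<^sup>2"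
      using 1 2 3 4 by linarith
    then show "norm (u i) \<le> 2 * norm (w' i)"
      by (rule power2_le_imp_le) simp
  qed
  have sum_w: "(\<Sum>i<Suc s. of_int (n i) *\<^sub>R w i) =
      of_int (n 0) *\<^sub>R b + (\<Sum>i<s. of_int (n (Suc i)) *\<^sub>R u i)" for n :: "nat \<Rightarrow> int"
    by (subst sum.lessThan_Suc_shift) simp
  have proj_u: "proj_away b (\<Sum>i<s. of_int (n i) *\<^sub>R u i) = (\<Sum>i<s. of_int (n i) *\<^sub>R w' i)"
    for n :: "nat \<Rightarrow> int"
    by (simp add: linear_sum[OF linear_proj_away] linear_scale[OF linear_proj_away] u(2))
  have "reduced_basis L (Suc s) w"
    unfolding reduced_basis_def
  proof (intro conjI allI ballI impI)
    fix i assume "i < Suc s"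
    then show "w i \<in> L" "w i \<noteq> 0"
      using b u(1) u0 by (cases i; simp)+
  next
    fix x assume x: "x \<in> L"
    then obtain m :: "nat \<Rightarrow> int" where m: "proj_away b x = (\<Sum>i<s. of_int (m i) *\<^sub>R w' i)"
      using w'_span by blast
    let ?y = "\<Sum>i<s. of_int (m i) *\<^sub>R u i"
    have "?y \<in> L"
    proof -
      have "(\<Sum>i<k. of_int (m i) *\<^sub>R u i) \<in> L" if "k \<le> s" for k
        using that
      proof (induction k)
        case 0
        then show ?case using L by (simp add: discrete_subgroup_def)
      next
        case (Suc k)
        then show ?case
          by (simp add: discrete_subgroup_add[OF L] discrete_subgroup_scale[OF L] u(1))
      qed
      then show ?thesis by simp
    qed
    \<comment> \<open>\<open>x\<close> and the lifted combination have the same projection, so their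
      difference lies in the kernel and is a multiple of the primitive vector
      \<open>b\<close>.\<close>
    then have "x - ?y \<in> L"
      using L x discrete_subgroup_diff by blast
    moreover have "proj_away b (x - ?y) = 0"
      using m proj_u[of m] by (simp add: linear_diff[OF linear_proj_away])
    ultimately obtain k :: int where "x - ?y = of_int k *\<^sub>R b"
      using shortest_vector_primitive[OF L b min] by metis
    then have "x = (\<Sum>i<Suc s. of_int (case_nat k m i) *\<^sub>R w i)"
      unfolding sum_w by (simp add: algebra_simps)
    then show "\<exists>n :: nat \<Rightarrow> int. x = (\<Sum>i<Suc s. of_int (n i) *\<^sub>R w i)"
      by blast
  next
    fix n :: "nat \<Rightarrow> int" and i
    assume i: "i < Suc s"
    let ?X = "\<Sum>j<Suc s. of_int (n j) *\<^sub>R w j"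
    have projX: "proj_away b ?X = (\<Sum>i<s. of_int (n (Suc i)) *\<^sub>R w' i)"
      unfolding sum_w
      by (simp add: linear_add[OF linear_proj_away] linear_scale[OF linear_proj_away] proj_u)
    have coeffX: "proj_coeff b ?X =
        of_int (n 0) + (\<Sum>i<s. of_int (n (Suc i)) * proj_coeff b (u i))"
      unfolding sum_w using b
      by (simp add: proj_coeff_add proj_coeff_scaleR proj_coeff_sum proj_coeff_self)
    have IH: "\<bar>of_int (n (Suc j))\<bar> * norm (w' j) \<le> fact s * norm ?X" if "j < s" for j
    proof -
      have "\<bar>of_int (n (Suc j))\<bar> * norm (w' j) \<le> fact s * norm (proj_away b ?X)"
        unfolding projX by (rule w'_bound[OF that])
      also have "\<dots> \<le> fact s * norm ?X"
        by (intro mult_left_mono norm_proj_away_le) simp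
      finally show ?thesis .
    qed
    show "\<bar>of_int (n i)\<bar> * norm (w i) \<le> fact (Suc s) * norm ?X"
    proof (cases i)
      case 0
      \<comment> \<open>The coefficient of the sum along \<open>b\<close> is \<open>n 0\<close> plus
        a combination of the \<open>n (Suc i)\<close> with weights at most 1/2. After multiplication
        by \<open>norm b \<le> 2 * norm (w' i)\<close> the induction hypothesis bounds each term;
        the total factor \<open>1 + s * fact s\<close> is at most
        \<open>fact (Suc s)\<close>.\<close>
      have "\<bar>of_int (n 0)\<bar> \<le>
          \<bar>proj_coeff b ?X\<bar> + \<bar>\<Sum>i<s. of_int (n (Suc i)) * proj_coeff b (u i)\<bar>"
        using coeffX by linarith
      also have "\<dots> \<le> \<bar>proj_coeff b ?X\<bar> + (\<Sum>i<s. \<bar>of_int (n (Suc i)) * proj_coeff b (u i)\<bar>)"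
        by (intro add_left_mono sum_abs)
      also have "\<dots> \<le> \<bar>proj_coeff b ?X\<bar> + (\<Sum>i<s. \<bar>of_int (n (Suc i))\<bar> / 2)"
      proof (intro add_left_mono sum_mono)
        fix j assume "j \<in> {..<s}"
        then have "\<bar>of_int (n (Suc j))\<bar> * \<bar>proj_coeff b (u j)\<bar> \<le> \<bar>of_int (n (Suc j))\<bar> * (1/2)"
          by (intro mult_left_mono u(3)) auto
        then show "\<bar>of_int (n (Suc j)) * proj_coeff b (u j)\<bar> \<le> \<bar>of_int (n (Suc j))\<bar> / 2"
          by (simp add: abs_mult)
      qed
      finally have "\<bar>of_int (n 0)\<bar> * norm b \<le>
          (\<bar>proj_coeff b ?X\<bar> + (\<Sum>i<s. \<bar>of_int (n (Suc i))\<bar> / 2)) * norm b"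
        by (rule mult_right_mono) simp
      also have "\<dots> = \<bar>proj_coeff b ?X\<bar> * norm b + (\<Sum>i<s. \<bar>of_int (n (Suc i))\<bar> / 2 * norm b)"
        by (simp only: distrib_right sum_distrib_right)
      also have "\<dots> \<le> norm ?X + (\<Sum>i<s. fact s * norm ?X)"
      proof (intro add_mono sum_mono abs_proj_coeff_le)
        fix j assume "j \<in> {..<s}"
        then have j: "j < s" by simp
        have "\<bar>of_int (n (Suc j))\<bar> / 2 * norm b \<le> \<bar>of_int (n (Suc j))\<bar> / 2 * (2 * norm (w' j))"
          by (intro mult_left_mono b_le j) simp
        then show "\<bar>of_int (n (Suc j))\<bar> / 2 * norm b \<le> fact s * norm ?X"
          using IH[OF j] by simp
      qed
      also have "\<dots> = (1 + real s * fact s) * norm ?X"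
        by (simp add: algebra_simps)
      also have "\<dots> \<le> fact (Suc s) * norm ?X"
        by (intro mult_right_mono) (auto simp: algebra_simps)
      finally show ?thesis
        using 0 by simp
    next
      case (Suc j)
      then have j: "j < s"
        using i by simp
      have "\<bar>of_int (n i)\<bar> * norm (w i) \<le> \<bar>of_int (n i)\<bar> * (2 * norm (w' j))"
        unfolding Suc w_simps by (intro mult_left_mono u_le j) simp
      also have "\<dots> \<le> 2 * (fact s * norm ?X)"
        using IH[OF j] Suc by simp
      \<comment> \<open>\<open>j < s\<close> forces \<open>s \<ge> 1\<close>, so the factor 2 from
        passing to the lift fits into \<open>1 + s\<close>.\<close>
      also have "\<dots> \<le> (1 + real s) * (fact s * norm ?X)"
        using j by (intro mult_right_mono) auto
      finally show ?thesis
        by (simp add: algebra_simps)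
    qed
  next
    fix \<rho> :: real
    assume \<rho>: "0 \<le> \<rho>"
    have pos: "0 \<le> 1 + 2 * \<rho> / norm x" for x :: 'a
      using \<rho> by simp
    \<comment> \<open>A lift is at most twice as long as \<open>w' i\<close>, so each factor loses
      at most 2 and the product at most \<open>2 ^ s\<close>. The exponent becomes
      \<open>s\<^sup>2 + s\<close>, which is at most \<open>(Suc s)\<^sup>2\<close>.\<close>
    have "(\<Prod>i<s. 1 + 2 * \<rho> / norm (w' i)) \<le> (\<Prod>i<s. 2 * (1 + 2 * \<rho> / norm (u i)))"
    proof (intro prod_mono conjI pos)
      fix i assume "i \<in> {..<s}"
      then have i: "i < s" by simp
      have "1 / norm (w' i) \<le> 2 / norm (u i)"
        using u_le[OF i] u0[OF i] w'0[OF i] by (simp add: field_simps)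
      then have "2 * \<rho> * (1 / norm (w' i)) \<le> 2 * \<rho> * (2 / norm (u i))"
        using \<rho> by (intro mult_left_mono) auto
      then show "1 + 2 * \<rho> / norm (w' i) \<le> 2 * (1 + 2 * \<rho> / norm (u i))"
        by simp
    qed
    also have "\<dots> = 2 ^ s * (\<Prod>i<s. 1 + 2 * \<rho> / norm (u i))"
      by (simp only: prod.distrib prod_constant card_lessThan)
    finally have prod_le: "(\<Prod>i<s. 1 + 2 * \<rho> / norm (w' i)) \<le> 2 ^ s * (\<Prod>i<s. 1 + 2 * \<rho> / norm (u i))" .
    have "real (card {x \<in> L. norm x \<le> \<rho>}) \<le>
        real (card {y \<in> proj_away b ` L. norm y \<le> \<rho>}) * (1 + 2 * \<rho> / norm b)"
      by (rule card_ball_proj_away[OF L b min \<rho>])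
    also have "\<dots> \<le> (2 ^ s\<^sup>2 * (\<Prod>i<s. 1 + 2 * \<rho> / norm (w' i))) * (1 + 2 * \<rho> / norm b)"
      by (intro mult_right_mono pos w'_card \<rho>)
    also have "\<dots> \<le> (2 ^ s\<^sup>2 * (2 ^ s * (\<Prod>i<s. 1 + 2 * \<rho> / norm (u i)))) * (1 + 2 * \<rho> / norm b)"
      by (intro mult_right_mono mult_left_mono prod_le pos) simp
    also have "\<dots> = 2 ^ (s\<^sup>2 + s) * (\<Prod>i<Suc s. 1 + 2 * \<rho> / norm (w i))"
      by (subst prod.lessThan_Suc_shift) (simp add: power_add mult_ac)
    also have "\<dots> \<le> 2 ^ (Suc s)\<^sup>2 * (\<Prod>i<Suc s. 1 + 2 * \<rho> / norm (w i))"
      by (intro mult_right_mono prod_nonneg pos power_increasing) (auto simp: power2_eq_square)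
    finally show "real (card {x \<in> L. norm x \<le> \<rho>}) \<le>
        2 ^ (Suc s)\<^sup>2 * (\<Prod>i<Suc s. 1 + 2 * \<rho> / norm (w i))" .
  qed
  then show ?thesis by (intro exI[of _ w])
qed

lemma ex_reduced_basis:
  assumes "discrete_subgroup L" "rank_at_most r L"
  shows "\<exists>s\<le>r. \<exists>w. reduced_basis L s w"
  using assms
proof (induction r arbitrary: L)
  case 0
  then have "L = {0}"
    using rank_at_most_0 by (auto simp: discrete_subgroup_def)
  then have "reduced_basis L 0 w" for w
    by (simp add: reduced_basis_def card_le_Suc0_iff_eq)
  then show ?case by blast
next
  case (Suc r)
  show ?case
  proof (cases "L \<subseteq> {0}")
    case True
    then have "rank_at_most r L"
      unfolding rank_at_most_def by (intro exI[of _ "{}"]) auto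
    then show ?thesis
      using Suc.IH Suc.prems le_SucI by blast
  next
    case False
    then obtain b where b: "b \<in> L" "b \<noteq> 0" "\<And>x. x \<in> L \<Longrightarrow> x \<noteq> 0 \<Longrightarrow> norm b \<le> norm x"
      using shortest_vector[OF Suc.prems(1)] by blast
    have "rank_at_most r (proj_away b ` L)"
      using rank_at_most_proj_away(2)[OF Suc.prems(2) b(1,2)] by simp
    then obtain s w' where "s \<le> r" "reduced_basis (proj_away b ` L) s w'"
      using Suc.IH discrete_subgroup_proj_away[OF Suc.prems(1) b(1)] by blast
    then show ?thesis
      using reduced_basis_step[OF Suc.prems(1) b] by blast
  qed
qed

subsection \<open>Eliminating short relations\<close>

text \<open>A subgroup of the product of the vector space and \<open>G\<close>. Finiteness concerns
  pairs, so it covers both the points in a ball and the fibre over each point.\<close>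

definition discrete_relation ::
    "('a, 'b) monoid_scheme \<Rightarrow> ('e::real_inner \<times> 'a) set \<Rightarrow> bool" where
  "discrete_relation G R \<longleftrightarrow> R \<subseteq> UNIV \<times> carrier G \<and> (0, \<one>\<^bsub>G\<^esub>) \<in> R \<and>
     (\<forall>x g y h. (x, g) \<in> R \<longrightarrow> (y, h) \<in> R \<longrightarrow> (x - y, g \<otimes>\<^bsub>G\<^esub> inv\<^bsub>G\<^esub> h) \<in> R) \<and>
     (\<forall>\<rho>. finite {z \<in> R. norm (fst z) \<le> \<rho>})"

definition proj_relation :: "'e::real_inner \<Rightarrow> ('e \<times> 'a) set \<Rightarrow> ('e \<times> 'a) set" where
  "proj_relation b R = (\<lambda>(x, g). (proj_away b x, g)) ` R"

lemma fst_proj_relation: "fst ` proj_relation b R = proj_away b ` (fst ` R)"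
  unfolding proj_relation_def image_image by (intro image_cong) auto

context comm_group
begin

section \<open>Group operations in a discrete relation\<close>

lemma discrete_relation_carrier: "discrete_relation G R \<Longrightarrow> (x, g) \<in> R \<Longrightarrow> g \<in> carrier G"
  unfolding discrete_relation_def by blast

lemma discrete_relation_zero: "discrete_relation G R \<Longrightarrow> (0, \<one>) \<in> R"
  unfolding discrete_relation_def by blast

lemma discrete_relation_diff:
  "discrete_relation G R \<Longrightarrow> (x, g) \<in> R \<Longrightarrow> (y, h) \<in> R \<Longrightarrow> (x - y, g \<otimes> inv h) \<in> R"
  unfolding discrete_relation_def by blast

lemma discrete_relation_uminus:
  assumes "discrete_relation G R" "(x, g) \<in> R"
  shows "(- x, inv g) \<in> R"
  using discrete_relation_diff[OF assms(1) discrete_relation_zero assms(2)] assms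
    discrete_relation_carrier[OF assms] by simp

lemma discrete_relation_add:
  assumes "discrete_relation G R" "(x, g) \<in> R" "(y, h) \<in> R"
  shows "(x + y, g \<otimes> h) \<in> R"
  using discrete_relation_diff[OF assms(1,2) discrete_relation_uminus[OF assms(1,3)]]
    discrete_relation_carrier[OF assms(1,3)] by simp

lemma discrete_relation_scale_nat:
  assumes "discrete_relation G R" "(x, g) \<in> R"
  shows "(of_nat k *\<^sub>R x, g [^] k) \<in> R"
proof (induction k)
  case 0
  then show ?case using discrete_relation_zero[OF assms(1)] by simp
next
  case (Suc k)
  then show ?case
    using discrete_relation_add[OF assms(1) Suc assms(2)] by (simp add: scaleR_left_distrib add.commute)
qed

lemma discrete_relation_scale:
  assumes "discrete_relation G R" "(x, g) \<in> R"
  shows "(of_int k *\<^sub>R x, g [^] k) \<in> R"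
proof (cases k)
  case (nonneg n)
  then show ?thesis
    using discrete_relation_scale_nat[OF assms, of n] by (simp add: int_pow_int)
next
  case (neg n)
  then show ?thesis
    using discrete_relation_uminus[OF assms(1) discrete_relation_scale_nat[OF assms, of "Suc n"]]
      discrete_relation_carrier[OF assms] by (simp only: int_pow_neg int_pow_int of_int_minus of_int_of_nat_eq scaleR_minus_left)
qed

lemma discrete_relation_sum:
  fixes n :: "nat \<Rightarrow> int"
  assumes R: "discrete_relation G R" and w: "\<And>i. i < s \<Longrightarrow> (w i, v i) \<in> R"
  shows "(\<Sum>i<s. of_int (n i) *\<^sub>R w i, \<Otimes>i\<in>{..<s}. v i [^] n i) \<in> R"
  using w
proof (induction s)
  case 0
  then show ?case using discrete_relation_zero[OF R] by simp
next
  case (Suc s)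
  have v: "v i \<in> carrier G" if "i < Suc s" for i
    using discrete_relation_carrier[OF R Suc.prems[OF that]] .
  have IH: "(\<Sum>i<s. of_int (n i) *\<^sub>R w i, \<Otimes>i\<in>{..<s}. v i [^] n i) \<in> R"
    by (intro Suc.IH Suc.prems) simp
  have "(\<Otimes>i\<in>{..<Suc s}. v i [^] n i) = (\<Otimes>i\<in>{..<s}. v i [^] n i) \<otimes> v s [^] n s"
    unfolding lessThan_Suc using v by (subst finprod_insert) (auto simp: m_comm)
  then show ?case
    using discrete_relation_add[OF R IH discrete_relation_scale[OF R Suc.prems[of s]], of "n s"] by simp
qed

lemma discrete_subgroup_fst:
  assumes R: "discrete_relation G R"
  shows "discrete_subgroup (fst ` R)"
  unfolding discrete_subgroup_def
proof (intro conjI ballI allI)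
  show "0 \<in> fst ` R"
    using discrete_relation_zero[OF R] by force
next
  fix x y assume "x \<in> fst ` R" "y \<in> fst ` R"
  then show "x - y \<in> fst ` R"
    using discrete_relation_diff[OF R] by force
next
  fix \<rho>
  have "finite (fst ` {z \<in> R. norm (fst z) \<le> \<rho>})"
    using R by (simp add: discrete_relation_def)
  moreover have "{x \<in> fst ` R. norm x \<le> \<rho>} = fst ` {z \<in> R. norm (fst z) \<le> \<rho>}"
    by auto
  ultimately show "finite {x \<in> fst ` R. norm x \<le> \<rho>}"
    by simp
qed

text \<open>\<open>b\<close> is paired with the identity of \<open>G\<close>, so subtracting
  multiples of \<open>b\<close> does not change the group element \<open>g\<close>.\<close>

lemma reduced_lift_relation:
  assumes R: "discrete_relation G R" and b: "(b, \<one>) \<in> R" and x: "(x, g) \<in> R"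
  obtains y where "(y, g) \<in> R" "proj_away b y = proj_away b x" "\<bar>proj_coeff b y\<bar> \<le> 1/2"
proof -
  obtain k :: int where k: "\<bar>proj_coeff b (x - of_int k *\<^sub>R b)\<bar> \<le> 1/2"
    by (rule reduce_modulo)
  have "(x - of_int k *\<^sub>R b, g) \<in> R"
    using discrete_relation_diff[OF R x discrete_relation_scale[OF R b, of k]]
      discrete_relation_carrier[OF R x] by (simp add: int_pow_one)
  then show ?thesis
    using that k proj_away_shift by blast
qed

lemma proj_relation_lift:
  assumes "discrete_relation G R" "(b, \<one>) \<in> R" "(y, g) \<in> proj_relation b R"
  obtains x where "(x, g) \<in> R" "proj_away b x = y" "\<bar>proj_coeff b x\<bar> \<le> 1/2"
proof -
  obtain x where "(x, g) \<in> R" "y = proj_away b x"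
    using assms(3) by (auto simp: proj_relation_def)
  then show ?thesis
    using reduced_lift_relation[OF assms(1,2)] that by metis
qed

lemma proj_relationI: "(x, g) \<in> R \<Longrightarrow> (proj_away b x, g) \<in> proj_relation b R"
  by (force simp: proj_relation_def)

text \<open>A reduced lift keeps the group element and lengthens the vector by at most
  \<open>norm b / 2\<close>, so finiteness over balls is inherited.\<close>

lemma discrete_relation_proj:
  assumes R: "discrete_relation G R" and b: "(b, \<one>) \<in> R"
  shows "discrete_relation G (proj_relation b R)"
  unfolding discrete_relation_def
proof (intro conjI allI impI)
  show "proj_relation b R \<subseteq> UNIV \<times> carrier G"
    using R by (auto simp: discrete_relation_def proj_relation_def)
  show "(0, \<one>) \<in> proj_relation b R"
    using proj_relationI[OF discrete_relation_zero[OF R], of b] by simp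
next
  fix x g y h assume "(x, g) \<in> proj_relation b R" "(y, h) \<in> proj_relation b R"
  then obtain x' y' where "(x', g) \<in> R" "x = proj_away b x'" "(y', h) \<in> R" "y = proj_away b y'"
    by (auto simp: proj_relation_def)
  then show "(x - y, g \<otimes> inv h) \<in> proj_relation b R"
    using proj_relationI[OF discrete_relation_diff[OF R], of x' g y' h b]
    by (simp add: linear_diff[OF linear_proj_away])
next
  fix \<rho>
  let ?f = "\<lambda>(x, g). (proj_away b x, g)"
  have "{z \<in> proj_relation b R. norm (fst z) \<le> \<rho>} \<subseteq>
      ?f ` {z \<in> R. norm (fst z) \<le> \<rho> + norm b / 2}"
  proof
    fix z assume z: "z \<in> {z \<in> proj_relation b R. norm (fst z) \<le> \<rho>}"
    obtain y g where yg: "z = (y, g)"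
      by fastforce
    then obtain x where x: "(x, g) \<in> R" "proj_away b x = y" "\<bar>proj_coeff b x\<bar> \<le> 1/2"
      using z proj_relation_lift[OF R b, of y g] by blast
    have "norm x \<le> \<rho> + norm b / 2"
      using norm_reduced_le[OF x(3)] x(2) z yg by simp
    then show "z \<in> ?f ` {z \<in> R. norm (fst z) \<le> \<rho> + norm b / 2}"
      using x yg by (intro image_eqI[of _ _ "(x, g)"]) simp_all
  qed
  moreover have "finite {z \<in> R. norm (fst z) \<le> \<rho> + norm b / 2}"
    using R by (simp add: discrete_relation_def)
  ultimately show "finite {z \<in> proj_relation b R. norm (fst z) \<le> \<rho>}"
    by (rule finite_surj[rotated])
qed

text \<open>Induction on the rank: a nonzero relation of norm at most \<open>\<delta>\<close> is
  projected away, which lowers the rank, so at most \<open>r\<close> rounds occur. Going forwards,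
  projection does not lengthen vectors; going backwards, each reduced lift adds at most
  \<open>\<delta>\<^sup>2 / 4\<close> to the squared norm.\<close>

lemma eliminate_short_relations:
  fixes R :: "('e::real_inner \<times> 'a) set"
  assumes "discrete_relation G R" "rank_at_most r (fst ` R)"
  shows "\<exists>R' :: ('e \<times> 'a) set. discrete_relation G R' \<and> rank_at_most r (fst ` R') \<and>
    (\<forall>x. (x, \<one>) \<in> R' \<longrightarrow> x = 0 \<or> \<delta> < norm x) \<and>
    (\<forall>x g. (x, g) \<in> R \<longrightarrow> (\<exists>y. (y, g) \<in> R' \<and> norm y \<le> norm x)) \<and>
    (\<forall>y g. (y, g) \<in> R' \<longrightarrow> (\<exists>x. (x, g) \<in> R \<and> (norm x)\<^sup>2 \<le> (norm y)\<^sup>2 + real r * \<delta>\<^sup>2 / 4))"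
  using assms
proof (induction r arbitrary: R)
  case 0
  have "fst ` R \<subseteq> {0}"
    using rank_at_most_0[OF 0(2)] .
  then have "\<And>x. (x, \<one>) \<in> R \<Longrightarrow> x = 0"
    by force
  then show ?case
    using 0 by (intro exI[of _ R]) auto
next
  case (Suc r)
  note R = Suc.prems(1)
  show ?case
  proof (cases "\<forall>x. (x, \<one>) \<in> R \<longrightarrow> x = 0 \<or> \<delta> < norm x")
    case True
    have "0 \<le> real (Suc r) * \<delta>\<^sup>2 / 4"
      by simp
    then show ?thesis
      using Suc.prems True by (intro exI[of _ R] conjI) (blast, blast, blast, blast, metis add.right_neutral add_left_mono)
  next
    case False
    then obtain b where b: "(b, \<one>) \<in> R" "b \<noteq> 0" "norm b \<le> \<delta>"
      by force
    have "b \<in> fst ` R"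
      using b by force
    then have "rank_at_most r (fst ` proj_relation b R)"
      using rank_at_most_proj_away(2)[OF Suc.prems(2) _ b(2)] by (simp add: fst_proj_relation)
    from Suc.IH[OF discrete_relation_proj[OF R b(1)] this]
    obtain R' :: "('e \<times> 'a) set" where R': "discrete_relation G R'" "rank_at_most r (fst ` R')"
        "\<forall>x. (x, \<one>) \<in> R' \<longrightarrow> x = 0 \<or> \<delta> < norm x"
        "\<And>x g. (x, g) \<in> proj_relation b R \<Longrightarrow> \<exists>y. (y, g) \<in> R' \<and> norm y \<le> norm x"
        "\<And>y g. (y, g) \<in> R' \<Longrightarrow>
          \<exists>x. (x, g) \<in> proj_relation b R \<and> (norm x)\<^sup>2 \<le> (norm y)\<^sup>2 + real r * \<delta>\<^sup>2 / 4"
      by blast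
    have "\<exists>y. (y, g) \<in> R' \<and> norm y \<le> norm x" if "(x, g) \<in> R" for x g
      using R'(4)[OF proj_relationI[OF that]] norm_proj_away_le order_trans by blast
    moreover have "\<exists>x. (x, g) \<in> R \<and> (norm x)\<^sup>2 \<le> (norm y)\<^sup>2 + real (Suc r) * \<delta>\<^sup>2 / 4"
      if "(y, g) \<in> R'" for y g
    proof -
      obtain z where z: "(z, g) \<in> proj_relation b R" "(norm z)\<^sup>2 \<le> (norm y)\<^sup>2 + real r * \<delta>\<^sup>2 / 4"
        using R'(5)[OF \<open>(y, g) \<in> R'\<close>] by blast
      obtain x where x: "(x, g) \<in> R" "proj_away b x = z" "\<bar>proj_coeff b x\<bar> \<le> 1/2"
        using proj_relation_lift[OF R b(1) z(1)] by blast
      have "(norm b)\<^sup>2 \<le> \<delta>\<^sup>2"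
        using b(3) by (intro power_mono) auto
      then have "(norm x)\<^sup>2 \<le> (norm y)\<^sup>2 + real (Suc r) * \<delta>\<^sup>2 / 4"
        using norm_reduced_sq[OF x(3)] x(2) z(2) by (simp add: field_simps)
      then show ?thesis
        using x(1) by blast
    qed
    ultimately show ?thesis
      using R'(1,3) rank_at_most_mono[OF R'(2), of "Suc r"]
      by (intro exI[of _ R'] conjI) simp_all
  qed
qed

end

subsection \<open>Coset progressions as discrete relations\<close>

lemma dilate_simps [simp]:
  "dims (dilate t P) = (\<lambda>i. t * dims P i)" "steps (dilate t P) = steps P"
  "cp_rank (dilate t P) = cp_rank P" "sym_group (dilate t P) = sym_group P"
  by (simp_all add: dilate_def)

lemma cp_element_dilate [simp]: "cp_element G (dilate t P) = cp_element G P"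
  by (simp add: fun_eq_iff cp_element_def)

lemma symmetric_coset_progression_dilate:
  "symmetric_coset_progression G P \<Longrightarrow> 0 < t \<Longrightarrow> symmetric_coset_progression G (dilate t P)"
  by (simp add: symmetric_coset_progression_def)

lemma dilate_1 [simp]: "dilate 1 P = P"
  by (simp add: dilate_def)

section \<open>Sizes of coefficient boxes\<close>

lemma card_int_abs_le:
  fixes x :: real
  assumes "0 \<le> x"
  shows "finite {k :: int. \<bar>of_int k\<bar> \<le> x}" "card {k :: int. \<bar>of_int k\<bar> \<le> x} = 2 * nat \<lfloor>x\<rfloor> + 1"
proof -
  have "\<bar>of_int k\<bar> \<le> x \<longleftrightarrow> k \<le> \<lfloor>x\<rfloor> \<and> - k \<le> \<lfloor>x\<rfloor>" for k :: int
    by (simp add: le_floor_iff abs_le_iff)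
  then have *: "{k :: int. \<bar>of_int k\<bar> \<le> x} = {- \<lfloor>x\<rfloor>..\<lfloor>x\<rfloor>}"
    by auto
  show "finite {k :: int. \<bar>of_int k\<bar> \<le> x}"
    by (simp add: *)
  show "card {k :: int. \<bar>of_int k\<bar> \<le> x} = 2 * nat \<lfloor>x\<rfloor> + 1"
  proof -
    have "0 \<le> \<lfloor>x\<rfloor>"
      using assms by simp
    then show ?thesis
      unfolding * card_atLeastAtMost_int by arith
  qed
qed

lemma finite_coefficient_box:
  assumes "\<And>i. i < cp_rank P \<Longrightarrow> 0 \<le> dims P i"
  shows "finite (coefficient_box P)"
  unfolding coefficient_box_def using assms card_int_abs_le by (intro finite_PiE) auto

lemma card_coefficient_box:
  assumes "\<And>i. i < cp_rank P \<Longrightarrow> 0 \<le> dims P i"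
  shows "card (coefficient_box P) = (\<Prod>i<cp_rank P. 2 * nat \<lfloor>dims P i\<rfloor> + 1)"
  unfolding coefficient_box_def using assms card_int_abs_le by (subst card_PiE) auto

text \<open>The number of integers of absolute value at most \<open>x\<close> is at least 1 and at
  least \<open>x\<close>, even when 0 is the only such integer.\<close>

lemma one_add_mult_le_card:
  fixes a x :: real
  assumes "0 \<le> a" "0 \<le> x"
  shows "1 + a * x \<le> (1 + a) * real (2 * nat \<lfloor>x\<rfloor> + 1)"
proof -
  have "0 \<le> real_of_int \<lfloor>x\<rfloor>"
    using assms(2) by simp
  then have "x \<le> 2 * real_of_int \<lfloor>x\<rfloor> + 1"
    using real_of_int_floor_add_one_ge[of x] by linarith
  then have "x \<le> real (2 * nat \<lfloor>x\<rfloor> + 1)"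
    using assms(2) by simp
  then have "a * x \<le> a * real (2 * nat \<lfloor>x\<rfloor> + 1)"
    using assms(1) by (intro mult_left_mono)
  moreover have "1 \<le> real (2 * nat \<lfloor>x\<rfloor> + 1)"
    by simp
  ultimately show ?thesis
    by (simp only: distrib_right mult_1_left)
qed

lemma coefficient_boxD: "n \<in> coefficient_box P \<Longrightarrow> i < cp_rank P \<Longrightarrow> \<bar>of_int (n i)\<bar> \<le> dims P i"
  by (simp add: coefficient_box_def PiE_iff)

lemma coefficient_box_eqI:
  assumes "n \<in> coefficient_box P" "m \<in> coefficient_box P" "\<And>i. i < cp_rank P \<Longrightarrow> n i = m i"
  shows "n = m"
  using assms(3) by (intro PiE_ext[OF assms(1,2)[unfolded coefficient_box_def]]) simp

definition zero_fibre :: "('e::real_inner \<times> 'a) set \<Rightarrow> 'a set" where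
  "zero_fibre R = {g. (0, g) \<in> R}"

text \<open>In these scaled coordinates the box of the dilate by \<open>t\<close> lies in the cube
  of side \<open>2 * t\<close> centred at 0, for every \<open>t\<close> at once.\<close>

definition cp_embed :: "'a coset_progression \<Rightarrow> (nat \<Rightarrow> int) \<Rightarrow> fin_seq" where
  "cp_embed P n = (\<Sum>i<cp_rank P. (of_int (n i) / dims P i) *\<^sub>R std_basis i)"

lemma coord_cp_embed: "i < cp_rank P \<Longrightarrow> coord (cp_embed P n) i = of_int (n i) / dims P i"
proof -
  assume "i < cp_rank P"
  have "coord (cp_embed P n) i = (\<Sum>j<cp_rank P. if i = j then of_int (n j) / dims P j else 0)"
    unfolding cp_embed_def coord_sum by (intro sum.cong) auto
  then show ?thesis
    using \<open>i < cp_rank P\<close> by simp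
qed

lemma cp_embed_diff: "cp_embed P n - cp_embed P m = cp_embed P (\<lambda>i. n i - m i)"
  by (simp add: cp_embed_def sum_subtractf scaleR_left_diff_distrib diff_divide_distrib)

context comm_group
begin

section \<open>Arithmetic of the elements of a coset progression\<close>

lemma cp_word_closed:
  "symmetric_coset_progression G P \<Longrightarrow> (\<Otimes>i\<in>{..<cp_rank P}. steps P i [^] (n i :: int)) \<in> carrier G"
  by (intro finprod_closed) (auto simp: symmetric_coset_progression_def)

lemma cp_sym_group_carrier:
  "symmetric_coset_progression G P \<Longrightarrow> h \<in> sym_group P \<Longrightarrow> h \<in> carrier G"
  by (auto simp: symmetric_coset_progression_def subgroup.mem_carrier)

lemma cp_element_closed:
  "symmetric_coset_progression G P \<Longrightarrow> h \<in> carrier G \<Longrightarrow> cp_element G P h n \<in> carrier G"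
  by (simp add: cp_element_def cp_word_closed)

lemma cp_element_mult:
  assumes P: "symmetric_coset_progression G P" and "h \<in> carrier G" "k \<in> carrier G"
  shows "cp_element G P h n \<otimes> cp_element G P k m = cp_element G P (h \<otimes> k) (\<lambda>i. n i + m i)"
proof -
  have "(\<Otimes>i\<in>{..<cp_rank P}. steps P i [^] (n i + m i)) =
      (\<Otimes>i\<in>{..<cp_rank P}. steps P i [^] n i \<otimes> steps P i [^] m i)"
    using P by (intro finprod_cong') (auto simp: symmetric_coset_progression_def int_pow_mult)
  also have "\<dots> = (\<Otimes>i\<in>{..<cp_rank P}. steps P i [^] n i) \<otimes> (\<Otimes>i\<in>{..<cp_rank P}. steps P i [^] m i)"
    using P by (intro finprod_multf) (auto simp: symmetric_coset_progression_def)
  finally show ?thesis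
    using assms cp_word_closed[OF P] by (simp add: cp_element_def m_ac)
qed

lemma cp_element_zero: "h \<in> carrier G \<Longrightarrow> cp_element G P h (\<lambda>_. 0) = h"
  by (simp add: cp_element_def finprod_one_eqI)

lemma cp_element_inv:
  assumes P: "symmetric_coset_progression G P" and "h \<in> carrier G"
  shows "inv (cp_element G P h n) = cp_element G P (inv h) (\<lambda>i. - n i)"
proof (rule inv_equality)
  show "cp_element G P (inv h) (\<lambda>i. - n i) \<otimes> cp_element G P h n = \<one>"
    using assms by (simp add: cp_element_mult cp_element_zero)
qed (use assms cp_element_closed[OF P] in auto)

lemma cp_element_cong:
  assumes P: "symmetric_coset_progression G P" and nm: "\<And>i. i < cp_rank P \<Longrightarrow> n i = m i"
  shows "cp_element G P h n = cp_element G P h m"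
proof -
  have "(\<Otimes>i\<in>{..<cp_rank P}. steps P i [^] n i) = (\<Otimes>i\<in>{..<cp_rank P}. steps P i [^] m i)"
    using assms by (intro finprod_cong') (auto simp: symmetric_coset_progression_def)
  then show ?thesis
    by (simp add: cp_element_def)
qed

text \<open>Members of \<open>coefficient_box\<close> are undefined outside the index range. Here
  \<open>n\<close> is arbitrary there, so that coefficient vectors can be added and negated
  freely.\<close>

lemma mem_cp_image_dilate_iff:
  assumes P: "symmetric_coset_progression G P"
  shows "g \<in> cp_image G (dilate t P) \<longleftrightarrow>
    (\<exists>h\<in>sym_group P. \<exists>n. (\<forall>i<cp_rank P. \<bar>of_int (n i)\<bar> \<le> t * dims P i) \<and> g = cp_element G P h n)"
    (is "_ \<longleftrightarrow> ?R")
proof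
  assume "g \<in> cp_image G (dilate t P)"
  then obtain h n where hn: "h \<in> sym_group P" "n \<in> coefficient_box (dilate t P)" "g = cp_element G P h n"
    by (auto simp: cp_image_def)
  then have "\<forall>i<cp_rank P. \<bar>of_int (n i)\<bar> \<le> t * dims P i"
    by (auto simp: coefficient_box_def PiE_iff)
  with hn show ?R
    by blast
next
  assume ?R
  then obtain h n where hn: "h \<in> sym_group P" "\<forall>i<cp_rank P. \<bar>of_int (n i)\<bar> \<le> t * dims P i"
      "g = cp_element G P h n"
    by blast
  let ?m = "restrict n {..<cp_rank P}"
  have "?m \<in> coefficient_box (dilate t P)"
    using hn(2) by (auto simp: coefficient_box_def)
  moreover have "g = cp_element G P h ?m"
    unfolding hn(3) by (intro cp_element_cong[OF P]) simp
  ultimately show "g \<in> cp_image G (dilate t P)"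
    unfolding cp_image_def using hn(1) by auto
qed

lemma cp_image_dilate_mono:
  assumes P: "symmetric_coset_progression G P" and "s \<le> t"
  shows "cp_image G (dilate s P) \<subseteq> cp_image G (dilate t P)"
proof
  fix g assume "g \<in> cp_image G (dilate s P)"
  then obtain h n where hn: "h \<in> sym_group P" "\<forall>i<cp_rank P. \<bar>of_int (n i)\<bar> \<le> s * dims P i"
      "g = cp_element G P h n"
    unfolding mem_cp_image_dilate_iff[OF P] by blast
  have "s * dims P i \<le> t * dims P i" if "i < cp_rank P" for i
    using P that assms(2) by (intro mult_right_mono) (auto simp: symmetric_coset_progression_def less_imp_le)
  then show "g \<in> cp_image G (dilate t P)"
    unfolding mem_cp_image_dilate_iff[OF P] using hn order_trans by blast
qed

lemma cp_image_conv: "cp_image G P = (\<lambda>(h, n). cp_element G P h n) ` (sym_group P \<times> coefficient_box P)"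
  by (auto simp: cp_image_def image_def)

lemma finite_cp_image:
  assumes "symmetric_coset_progression G P"
  shows "finite (cp_image G P)"
  unfolding cp_image_conv using assms finite_coefficient_box[of P]
  by (intro finite_imageI finite_cartesian_product) (auto simp: symmetric_coset_progression_def less_imp_le)

lemma cp_size_proper:
  assumes "symmetric_coset_progression G P" "proper G P"
  shows "cp_size G P = card (sym_group P) * (\<Prod>i<cp_rank P. 2 * nat \<lfloor>dims P i\<rfloor> + 1)"
  using assms unfolding cp_size_def cp_image_conv
  by (simp add: proper_def card_image card_cartesian_product card_coefficient_box
      symmetric_coset_progression_def less_imp_le)

lemma proper_if_t_proper:
  assumes P: "symmetric_coset_progression G P" and "t_proper G t P" "1 \<le> t"
  shows "proper G P"
proof -
  have "coefficient_box P \<subseteq> coefficient_box (dilate t P)"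
  proof -
    have "dims P i \<le> t * dims P i" if "i < cp_rank P" for i
      using P that assms(3) by (auto simp: symmetric_coset_progression_def)
    then show ?thesis
      unfolding coefficient_box_def dilate_simps by (intro PiE_mono) (auto intro: order_trans)
  qed
  then show ?thesis
    using assms(2) by (auto simp: t_proper_def proper_def intro: inj_on_subset)
qed

section \<open>The fibre over zero, and the pairs over a ball\<close>

lemma subgroup_zero_fibre:
  assumes R: "discrete_relation G R"
  shows "subgroup (zero_fibre R) G" "finite (zero_fibre R)"
proof -
  show "subgroup (zero_fibre R) G"
  proof
    show "zero_fibre R \<subseteq> carrier G"
      using discrete_relation_carrier[OF R] by (auto simp: zero_fibre_def)
    show "x \<otimes> y \<in> zero_fibre R" if "x \<in> zero_fibre R" "y \<in> zero_fibre R" for x y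
      using discrete_relation_add[OF R, of 0 x 0 y] that by (simp add: zero_fibre_def)
    show "\<one> \<in> zero_fibre R"
      using discrete_relation_zero[OF R] by (simp add: zero_fibre_def)
    show "inv x \<in> zero_fibre R" if "x \<in> zero_fibre R" for x
      using discrete_relation_uminus[OF R, of 0 x] that by (simp add: zero_fibre_def)
  qed
  have "zero_fibre R \<subseteq> snd ` {z \<in> R. norm (fst z) \<le> 0}"
    by (force simp: zero_fibre_def)
  moreover have "finite {z \<in> R. norm (fst z) \<le> 0}"
    using R unfolding discrete_relation_def by blast
  ultimately show "finite (zero_fibre R)"
    using finite_surj by blast
qed

text \<open>Dividing by the group element of one fixed pair over \<open>x\<close> injects the fibre
  over \<open>x\<close> into the fibre over 0.\<close>

lemma card_relation_ball:
  assumes R: "discrete_relation G R"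
  shows "card {z \<in> R. norm (fst z) \<le> \<rho>} \<le> card {x \<in> fst ` R. norm x \<le> \<rho>} * card (zero_fibre R)"
proof -
  let ?X = "{x \<in> fst ` R. norm x \<le> \<rho>}"
  let ?F = "\<lambda>x. {z \<in> R. fst z = x}"
  have fin: "finite ?X"
    using discrete_subgroup_fst[OF R] by (simp add: discrete_subgroup_def)
  have "card (?F x) \<le> card (zero_fibre R)" if x: "x \<in> ?X" for x
  proof -
    obtain g where g: "(x, g) \<in> R"
      using x by auto
    have "inj_on (\<lambda>z. snd z \<otimes> inv g) (?F x)"
    proof (rule inj_onI)
      fix y z assume yz: "y \<in> ?F x" "z \<in> ?F x" "snd y \<otimes> inv g = snd z \<otimes> inv g"
      have "snd y \<in> carrier G" "snd z \<in> carrier G" "inv g \<in> carrier G"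
        using yz discrete_relation_carrier[OF R] g by (metis (mono_tags) mem_Collect_eq prod.collapse inv_closed)+
      then have "snd y = snd z"
        using yz(3) by simp
      then show "y = z"
        using yz(1,2) by (simp add: prod_eq_iff)
    qed
    moreover have "(\<lambda>z. snd z \<otimes> inv g) ` ?F x \<subseteq> zero_fibre R"
    proof clarify
      fix y h assume "(y, h) \<in> R" "x = fst (y, h)"
      then show "snd (y, h) \<otimes> inv g \<in> zero_fibre R"
        using discrete_relation_diff[OF R _ g, of y h] by (simp add: zero_fibre_def)
    qed
    ultimately show ?thesis
      using card_inj_on_le subgroup_zero_fibre(2)[OF R] by blast
  qed
  then have le: "(\<Sum>x\<in>?X. card (?F x)) \<le> (\<Sum>x\<in>?X. card (zero_fibre R))"
    by (rule sum_mono)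
  have "{z \<in> R. norm (fst z) \<le> \<rho>} = (\<Union>x\<in>?X. ?F x)"
    by auto
  then have "card {z \<in> R. norm (fst z) \<le> \<rho>} \<le> (\<Sum>x\<in>?X. card (?F x))"
    using card_UN_le[OF fin, of ?F] by presburger
  also note le
  finally show ?thesis
    by simp
qed

text \<open>Each scaled coordinate is at most \<open>t\<close>. The triangle inequality gives the
  factor \<open>cp_rank P\<close>, cruder than its square root but absorbed by the
  constants.\<close>

lemma norm_cp_embed_le:
  assumes P: "symmetric_coset_progression G P"
    and n: "\<And>i. i < cp_rank P \<Longrightarrow> \<bar>of_int (n i)\<bar> \<le> t * dims P i"
  shows "norm (cp_embed P n) \<le> real (cp_rank P) * t"
proof -
  have "norm (cp_embed P n) \<le> (\<Sum>i<cp_rank P. norm ((of_int (n i) / dims P i) *\<^sub>R std_basis i))"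
    unfolding cp_embed_def by (rule norm_sum)
  also have "\<dots> \<le> (\<Sum>i<cp_rank P. t)"
  proof (rule sum_mono)
    fix i assume "i \<in> {..<cp_rank P}"
    then have "0 < dims P i" "\<bar>of_int (n i)\<bar> \<le> t * dims P i"
      using P n by (auto simp: symmetric_coset_progression_def)
    then show "norm ((of_int (n i) / dims P i) *\<^sub>R std_basis i) \<le> t"
      by (simp add: abs_divide field_simps)
  qed
  finally show ?thesis
    by simp
qed

text \<open>All integer coefficient vectors occur, not only those in the box, which makes this a
  group that is the source of every dilate of \<open>P\<close>.\<close>

definition cp_relation :: "'a coset_progression \<Rightarrow> (fin_seq \<times> 'a) set" where
  "cp_relation P = {(cp_embed P n, cp_element G P h n) | h n. h \<in> sym_group P}"

text \<open>Membership in a dilate is controlled by the supremum norm alone. This permits lifting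
  along a relation whose coordinates are small although its Euclidean norm may not be.\<close>

lemma mem_cp_image_of_coord:
  assumes P: "symmetric_coset_progression G P" and "(x, g) \<in> cp_relation P"
    and x: "\<And>i. i < cp_rank P \<Longrightarrow> \<bar>coord x i\<bar> \<le> t"
  shows "g \<in> cp_image G (dilate t P)"
proof -
  obtain h n where hn: "h \<in> sym_group P" "x = cp_embed P n" "g = cp_element G P h n"
    using assms(2) by (auto simp: cp_relation_def)
  have "\<bar>of_int (n i)\<bar> \<le> t * dims P i" if i: "i < cp_rank P" for i
  proof -
    have "0 < dims P i"
      using P i by (simp add: symmetric_coset_progression_def)
    then show ?thesis
      using x[OF i] unfolding hn(2) coord_cp_embed[OF i] by (simp add: abs_divide field_simps)
  qed
  then show ?thesis
    unfolding mem_cp_image_dilate_iff[OF P] using hn by blast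
qed

lemma cp_image_obtain_relation:
  assumes P: "symmetric_coset_progression G P" and "g \<in> cp_image G (dilate t P)"
  obtains x where "(x, g) \<in> cp_relation P" "norm x \<le> real (cp_rank P) * t"
proof -
  obtain h n where hn: "h \<in> sym_group P" "\<forall>i<cp_rank P. \<bar>of_int (n i)\<bar> \<le> t * dims P i"
      "g = cp_element G P h n"
    using assms(2) unfolding mem_cp_image_dilate_iff[OF P] by blast
  then show ?thesis
    using that[of "cp_embed P n"] norm_cp_embed_le[OF P] by (auto simp: cp_relation_def)
qed

lemma cp_relation_diff:
  assumes P: "symmetric_coset_progression G P"
    and "(x, g) \<in> cp_relation P" "(y, k) \<in> cp_relation P"
  shows "(x - y, g \<otimes> inv k) \<in> cp_relation P"
proof -
  obtain h n where hn: "h \<in> sym_group P" "x = cp_embed P n" "g = cp_element G P h n"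
    using assms(2) by (auto simp: cp_relation_def)
  obtain l m where lm: "l \<in> sym_group P" "y = cp_embed P m" "k = cp_element G P l m"
    using assms(3) by (auto simp: cp_relation_def)
  have sub: "subgroup (sym_group P) G"
    using P by (simp add: symmetric_coset_progression_def)
  have "h \<otimes> inv l \<in> sym_group P"
    using sub hn lm by (simp add: subgroup.m_closed subgroup.m_inv_closed)
  moreover have "x - y = cp_embed P (\<lambda>i. n i - m i)"
    by (simp add: hn lm cp_embed_diff)
  moreover have "g \<otimes> inv k = cp_element G P (h \<otimes> inv l) (\<lambda>i. n i - m i)"
    using hn lm cp_sym_group_carrier[OF P] by (simp add: cp_element_inv[OF P] cp_element_mult[OF P])
  ultimately show ?thesis
    unfolding cp_relation_def by blast
qed

lemma cp_relation_zero:
  assumes P: "symmetric_coset_progression G P" and h: "h \<in> sym_group P"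
  shows "(0, h) \<in> cp_relation P"
proof -
  have "cp_embed P (\<lambda>_. 0) = 0"
    by (simp add: cp_embed_def)
  then show ?thesis
    unfolding cp_relation_def using h cp_element_zero[OF cp_sym_group_carrier[OF P h], of P] by force
qed

lemma discrete_cp_relation:
  assumes P: "symmetric_coset_progression G P"
  shows "discrete_relation G (cp_relation P)"
  unfolding discrete_relation_def
proof (intro conjI allI impI)
  show "cp_relation P \<subseteq> UNIV \<times> carrier G"
    using cp_element_closed[OF P] cp_sym_group_carrier[OF P] by (auto simp: cp_relation_def)
  show "(0, \<one>) \<in> cp_relation P"
    using P by (intro cp_relation_zero) (auto simp: symmetric_coset_progression_def subgroup.one_closed)
next
  fix \<rho>
  have dims: "0 < dims P i" if "i < cp_rank P" for i
    using P that by (simp add: symmetric_coset_progression_def)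
  \<comment> \<open>The norm bounds every scaled coordinate, so only finitely many coefficient
    vectors contribute. The absolute value keeps the dimensions nonnegative when
    \<open>\<rho> < 0\<close>.\<close>
  have "{z \<in> cp_relation P. norm (fst z) \<le> \<rho>} \<subseteq> (\<lambda>(h, n). (cp_embed P n, cp_element G P h n)) `
      (sym_group P \<times> coefficient_box (dilate \<bar>\<rho>\<bar> P))"
  proof
    fix z assume "z \<in> {z \<in> cp_relation P. norm (fst z) \<le> \<rho>}"
    then obtain h n where hn: "h \<in> sym_group P" "z = (cp_embed P n, cp_element G P h n)"
        "norm (cp_embed P n) \<le> \<rho>"
      by (auto simp: cp_relation_def)
    let ?m = "restrict n {..<cp_rank P}"
    have "\<bar>of_int (n i)\<bar> \<le> \<bar>\<rho>\<bar> * dims P i" if i: "i < cp_rank P" for i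
    proof -
      have "\<bar>of_int (n i) / dims P i\<bar> \<le> \<bar>\<rho>\<bar>"
        using abs_coord_le_norm[of "cp_embed P n" i] hn(3) by (simp add: coord_cp_embed[OF i])
      then show ?thesis
        using dims[OF i] by (simp add: abs_divide field_simps)
    qed
    then have "?m \<in> coefficient_box (dilate \<bar>\<rho>\<bar> P)"
      by (auto simp: coefficient_box_def)
    moreover have "cp_embed P n = cp_embed P ?m"
      unfolding cp_embed_def by (intro sum.cong) auto
    moreover have "cp_element G P h n = cp_element G P h ?m"
      by (intro cp_element_cong[OF P]) simp
    ultimately show "z \<in> (\<lambda>(h, n). (cp_embed P n, cp_element G P h n)) `
        (sym_group P \<times> coefficient_box (dilate \<bar>\<rho>\<bar> P))"
      using hn by (intro image_eqI[of _ _ "(h, ?m)"]) auto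
  qed
  moreover have "finite (sym_group P \<times> coefficient_box (dilate \<bar>\<rho>\<bar> P))"
    using P dims by (intro finite_cartesian_product finite_coefficient_box)
      (auto simp: symmetric_coset_progression_def less_imp_le)
  ultimately show "finite {z \<in> cp_relation P. norm (fst z) \<le> \<rho>}"
    by (rule finite_surj[rotated])
qed (use cp_relation_diff[OF P] in blast)

lemma rank_cp_relation: "rank_at_most (cp_rank P) (fst ` cp_relation P)"
  unfolding rank_at_most_def
proof (intro exI conjI)
  show "card (std_basis ` {..<cp_rank P}) \<le> cp_rank P"
    using card_image_le[of "{..<cp_rank P}" std_basis] by simp
  show "fst ` cp_relation P \<subseteq> span (std_basis ` {..<cp_rank P})"
  proof clarify
    fix x g assume "(x, g) \<in> cp_relation P"
    then obtain n where x: "x = cp_embed P n"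
      by (auto simp: cp_relation_def)
    show "fst (x, g) \<in> span (std_basis ` {..<cp_rank P})"
      unfolding x fst_conv cp_embed_def by (intro span_sum span_scale span_base imageI)
  qed
qed simp

end

subsection \<open>Approximation with constant 32\<close>

text \<open>The left side is the loss in bounding the coefficients of a point of \<open>P\<close> in
  the basis of \<open>Q\<close>. It is at most \<open>d ^ d * 128 ^ d\<close>, because
  \<open>fact s \<le> d ^ d\<close> and the rest is at most \<open>16 * d ^ 3\<close>. Then
  \<open>128 * d \<le> (32 * d) powr (3/2)\<close>, since the squares have constants
  \<open>2 ^ 14\<close> and \<open>2 ^ 15\<close>.\<close>

lemma expansion_factor_ge:
  assumes "0 < d" "s \<le> d"
  shows "fact s * real d * (4 * (real d + 1)\<^sup>2) \<le> expansion_factor 32 d"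
proof -
  have d: "1 \<le> real d"
    using assms by simp
  have "(fact s :: real) \<le> fact d"
    using assms by (intro fact_mono)
  also have "\<dots> \<le> real d ^ d"
    using fact_le_power[of d, where 'a = real] by simp
  finally have f: "(fact s :: real) \<le> real d ^ d" .
  have "(real d + 1)\<^sup>2 \<le> (2 * real d)\<^sup>2"
    using d by (intro power_mono) auto
  then have "real d * (4 * (real d + 1)\<^sup>2) \<le> real d * (4 * (2 * real d)\<^sup>2)"
    using d by (intro mult_left_mono) auto
  also have "\<dots> = 16 * real d ^ 3"
    by (simp add: power2_eq_square power3_eq_cube)
  also have "\<dots> \<le> 16 ^ d * (2 ^ d) ^ 3"
  proof (intro mult_mono power_mono)
    show "(16::real) \<le> 16 ^ d"
      using power_increasing[of 1 d "16::real"] assms(1) by simp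
    have "real d < real (2 ^ d)"
      unfolding of_nat_less_iff by (rule less_exp)
    then show "real d \<le> 2 ^ d"
      by simp
  qed auto
  also have "\<dots> = 128 ^ d"
    by (simp add: power_mult[symmetric] mult.commute[of d] flip: power_mult_distrib) (simp add: power_mult flip: power_mult_distrib)
  finally have *: "real d * (4 * (real d + 1)\<^sup>2) \<le> 128 ^ d" .
  have "fact s * real d * (4 * (real d + 1)\<^sup>2) \<le> real d ^ d * 128 ^ d"
    using mult_mono[OF f *] by (simp add: mult.assoc)
  also have "\<dots> = (128 * real d) powr real d"
    using d by (simp add: powr_realpow power_mult_distrib mult.commute)
  also have "\<dots> \<le> ((32 * real d) powr (3/2)) powr real d"
  proof (intro powr_mono2)
    have "(128 * real d)\<^sup>2 \<le> (32 * real d) ^ 3"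
      using d by (simp add: power2_eq_square power3_eq_cube)
    also have "\<dots> = ((32 * real d) powr (3/2))\<^sup>2"
    proof -
      have "((32 * real d) powr (3/2))\<^sup>2 = (32 * real d) powr (3/2 + 3/2)"
        by (simp only: powr_add power2_eq_square)
      also have "\<dots> = (32 * real d) powr real 3"
        by simp
      also have "\<dots> = (32 * real d) ^ 3"
        using d by (intro powr_realpow) simp
      finally show ?thesis ..
    qed
    finally show "128 * real d \<le> (32 * real d) powr (3/2)"
      by (rule power2_le_imp_le) simp
  qed auto
  also have "\<dots> = expansion_factor 32 d"
    using assms(1) by (simp add: expansion_factor_def powr_powr)
  finally show ?thesis .
qed

lemma ln_2_ge_half: "1 / 2 \<le> ln (2 :: real)"
  using ln_le_minus_one[of "1 / 2 :: real"] by (simp add: ln_div)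

text \<open>The left side is the loss in comparing a ball of lattice points with the box of
  \<open>Q\<close>. As \<open>t \<ge> 1\<close>, it is at most
  \<open>2 ^ d\<^sup>2 * (?A * t) ^ d\<close>, where \<open>?A\<close> is polynomial in
  \<open>d\<close> and thus contributes the exponent \<open>32 * d * ln (d + 1)\<close>.\<close>

lemma size_loss_le:
  fixes t :: real
  assumes "s \<le> d" "1 \<le> t"
  shows "2 ^ s\<^sup>2 * (1 + 2 * real d * (4 * (real d + 1)\<^sup>2) * t) ^ s \<le>
    t powr real d * 2 powr ((real d)\<^sup>2 + 32 * real d * ln (real d + 1))"
proof (cases "d = 0")
  case True
  then show ?thesis
    using assms by simp
next
  case False
  then have d: "1 \<le> real d"
    by simp
  let ?A = "1 + 2 * real d * (4 * (real d + 1)\<^sup>2)"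
  have A1: "1 \<le> ?A"
    using d by simp
  have "1 + 2 * real d * (4 * (real d + 1)\<^sup>2) * t \<le> ?A * t"
    using assms by (simp add: algebra_simps)
  then have "(1 + 2 * real d * (4 * (real d + 1)\<^sup>2) * t) ^ s \<le> (?A * t) ^ s"
    using d assms by (intro power_mono) auto
  also have "\<dots> \<le> (?A * t) ^ d"
    using assms A1 mult_mono[OF A1 assms(2)] by (intro power_increasing) auto
  finally have 1: "(1 + 2 * real d * (4 * (real d + 1)\<^sup>2) * t) ^ s \<le> (?A * t) ^ d" .
  have "s\<^sup>2 \<le> d\<^sup>2"
    using assms by (intro power_mono) auto
  then have 2: "(2::real) ^ s\<^sup>2 \<le> 2 ^ d\<^sup>2"
    by (intro power_increasing) auto
  have "?A \<le> (real d + 1) ^ 6"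
  proof -
    have p: "1 \<le> (real d + 1) ^ 3" "8 \<le> (real d + 1) ^ 3"
      using power_mono[of 2 "real d + 1" 3] d by simp_all
    have "2 * real d * (4 * (real d + 1)\<^sup>2) \<le> 8 * (real d + 1) ^ 3 - 8"
      using d by (simp add: power2_eq_square power3_eq_cube algebra_simps)
    then have "?A \<le> 8 * (real d + 1) ^ 3"
      by simp
    also have "\<dots> \<le> (real d + 1) ^ 3 * (real d + 1) ^ 3"
      using p by (intro mult_right_mono) auto
    finally show ?thesis
      by (simp add: power_add[symmetric])
  qed
  also have "\<dots> = (real d + 1) powr 6"
    using d powr_realpow[of "real d + 1" 6] by simp
  \<comment> \<open>\<open>ln 2 \<ge> 1 / 2\<close> gives \<open>6 \<le> 32 * ln 2\<close>; this
    exponent converts into a power of 2.\<close>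
  also have "\<dots> \<le> (real d + 1) powr (32 * ln 2)"
    using d ln_2_ge_half by (intro powr_mono) auto
  also have "\<dots> = 2 powr (32 * ln (real d + 1))"
    using d by (simp add: powr_def mult_ac)
  finally have 3: "?A \<le> 2 powr (32 * ln (real d + 1))" .
  have "?A ^ d \<le> (2 powr (32 * ln (real d + 1))) ^ d"
    using A1 by (intro power_mono 3) auto
  also have "\<dots> = 2 powr (32 * real d * ln (real d + 1))"
    by (simp add: powr_powr mult_ac flip: powr_realpow)
  finally have 4: "?A ^ d \<le> 2 powr (32 * real d * ln (real d + 1))" .
  have "2 ^ s\<^sup>2 * (1 + 2 * real d * (4 * (real d + 1)\<^sup>2) * t) ^ s \<le> 2 ^ d\<^sup>2 * (?A * t) ^ d"
    using 1 2 assms d by (intro mult_mono) auto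
  also have "\<dots> = t ^ d * (2 ^ d\<^sup>2 * ?A ^ d)"
    by (simp only: power_mult_distrib mult_ac)
  also have "\<dots> \<le> t ^ d * (2 ^ d\<^sup>2 * 2 powr (32 * real d * ln (real d + 1)))"
    using 4 assms by (intro mult_left_mono) auto
  also have "\<dots> = t powr real d * 2 powr ((real d)\<^sup>2 + 32 * real d * ln (real d + 1))"
    using assms by (simp add: powr_realpow powr_add flip: of_nat_power)
  finally show ?thesis .
qed

section \<open>Construction of the proper progression\<close>

context comm_group
begin

text \<open>\<open>to_R\<close> and \<open>from_R\<close> compare balls of \<open>R\<close> with
  dilates of \<open>P\<close> and yield the two inclusions of images; \<open>no_short\<close> yields
  properness.\<close>

lemma proper_approximation_of_reduced_relation:
  fixes R :: "('e::real_inner \<times> 'a) set" and t :: real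
  assumes P: "symmetric_coset_progression G P" and t: "1 \<le> t"
    and R: "discrete_relation G R" and rank: "rank_at_most r (fst ` R)" "r \<le> cp_rank P"
    and sym: "\<And>h. h \<in> sym_group P \<Longrightarrow> (0, h) \<in> R"
    and to_R: "\<And>g t'. 0 < t' \<Longrightarrow> g \<in> cp_image G (dilate t' P) \<Longrightarrow>
        \<exists>x. (x, g) \<in> R \<and> norm x \<le> real (cp_rank P) * t'"
    and from_R: "\<And>x g t'. 1 \<le> t' \<Longrightarrow> (x, g) \<in> R \<Longrightarrow> norm x \<le> t' / 4 \<Longrightarrow> g \<in> cp_image G (dilate t' P)"
    and no_short: "\<And>x. (x, \<one>) \<in> R \<Longrightarrow> x \<noteq> 0 \<Longrightarrow> 1 / (2 * (real (cp_rank P) + 1)) < norm x"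
  shows "\<exists>Q. proper_approximation G 32 t P Q \<and> cp_rank Q \<le> r"
proof -
  define d where "d = cp_rank P"
  \<comment> \<open>Small enough for two purposes: \<open>d * \<kappa> \<le> 1 / 4\<close> matches
    \<open>from_R\<close>, and \<open>2 * d * \<kappa>\<close> stays below the length of every
    nontrivial relation. The shift to \<open>d + 1\<close> keeps the denominator positive when
    \<open>d = 0\<close>.\<close>
  define \<kappa> where "\<kappa> = 1 / (4 * (real d + 1)\<^sup>2)"
  have \<kappa>: "0 < \<kappa>" "real d * \<kappa> \<le> 1 / 4" "2 * real d * \<kappa> \<le> 1 / (2 * (real d + 1))"
  proof -
    show "0 < \<kappa>"
      unfolding \<kappa>_def by (simp add: add_nonneg_eq_0_iff)
    have "2 * x * (1 / (4 * u\<^sup>2)) = 1 / (2 * u) * (x / u)" if "u \<noteq> 0" for x u :: real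
      using that by (simp add: field_simps power2_eq_square)
    from this[of "real d + 1" "real d"]
    have "2 * real d * \<kappa> = 1 / (2 * (real d + 1)) * (real d / (real d + 1))"
      unfolding \<kappa>_def by (simp add: add_nonneg_eq_0_iff)
    also have "\<dots> \<le> 1 / (2 * (real d + 1)) * 1"
      by (intro mult_left_mono) (auto simp: field_simps)
    finally show 1: "2 * real d * \<kappa> \<le> 1 / (2 * (real d + 1))"
      by simp
    also have "\<dots> \<le> 1 / 2"
      by (simp add: field_simps)
    finally show "real d * \<kappa> \<le> 1 / 4"
      by simp
  qed
  obtain s w where s: "s \<le> r" and w: "reduced_basis (fst ` R) s w"
    using ex_reduced_basis[OF discrete_subgroup_fst[OF R] rank(1)] by blast
  have sd: "s \<le> d"
    using s rank(2) by (simp add: d_def)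
  have w_in: "w i \<in> fst ` R" and w0: "w i \<noteq> 0" if "i < s" for i
    using w that unfolding reduced_basis_def by blast+
  have w_span: "\<exists>n :: nat \<Rightarrow> int. x = (\<Sum>i<s. of_int (n i) *\<^sub>R w i)" if "x \<in> fst ` R" for x
    using w that unfolding reduced_basis_def by blast
  have w_bound: "\<bar>of_int (n i)\<bar> * norm (w i) \<le> fact s * norm (\<Sum>j<s. of_int (n j) *\<^sub>R w j)"
    if "i < s" for n :: "nat \<Rightarrow> int" and i
    using w that unfolding reduced_basis_def by blast
  have w_card: "real (card {x \<in> fst ` R. norm x \<le> \<rho>}) \<le> 2 ^ s\<^sup>2 * (\<Prod>i<s. 1 + 2 * \<rho> / norm (w i))"
    if "0 \<le> \<rho>" for \<rho>
    using w that unfolding reduced_basis_def by blast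
  have "\<exists>g. (w i, g) \<in> R" if i: "i < s" for i
    using w_in[OF i] by auto
  then obtain v where v: "\<And>i. i < s \<Longrightarrow> (w i, v i) \<in> R"
    by metis
  \<comment> \<open>The division by \<open>t\<close> cancels in the dilate by \<open>t * t'\<close>,
    whose box is given by \<open>\<bar>n i\<bar> * norm (w i) \<le> \<kappa> * t'\<close>.\<close>
  define Q where "Q = \<lparr>dims = (\<lambda>i. \<kappa> / (t * norm (w i))), steps = v, cp_rank = s,
      sym_group = zero_fibre R\<rparr>"
  have Q_simps [simp]: "dims Q = (\<lambda>i. \<kappa> / (t * norm (w i)))" "steps Q = v" "cp_rank Q = s"
      "sym_group Q = zero_fibre R"
    by (simp_all add: Q_def)
  have Q: "symmetric_coset_progression G Q"
    using subgroup_zero_fibre[OF R] \<kappa>(1) t w0 v discrete_relation_carrier[OF R]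
    by (auto simp: symmetric_coset_progression_def)
  let ?W = "\<lambda>n :: nat \<Rightarrow> int. \<Sum>i<s. of_int (n i) *\<^sub>R w i"
  have Q_in_R: "(?W n, cp_element G Q h n) \<in> R" if "h \<in> zero_fibre R" for h n
  proof -
    have "(0, h) \<in> R"
      using that by (simp add: zero_fibre_def)
    from discrete_relation_add[OF R this discrete_relation_sum[OF R v]] show ?thesis
      by (simp add: cp_element_def)
  qed
  have W_norm: "norm (?W n) \<le> real d * a" if n: "\<And>i. i < s \<Longrightarrow> \<bar>of_int (n i)\<bar> * norm (w i) \<le> a"
    and a: "0 \<le> a" for n a
  proof -
    have "norm (?W n) \<le> (\<Sum>i<s. norm (of_int (n i) *\<^sub>R w i))"
      by (rule norm_sum)
    also have "\<dots> \<le> (\<Sum>i<s. a)"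
      using n by (intro sum_mono) simp
    also have "\<dots> \<le> real d * a"
      using sd a by (simp add: mult_right_mono)
    finally show ?thesis .
  qed
  have box: "\<bar>of_int k\<bar> \<le> (t * t') * dims Q i \<longleftrightarrow> \<bar>of_int k\<bar> * norm (w i) \<le> \<kappa> * t'"
    if "i < s" for i k t'
    using t w0[OF that] by (simp add: field_simps)
  have Q_sub_P: "cp_image G (dilate (t * t') Q) \<subseteq> cp_image G (dilate t' P)" if t': "1 \<le> t'" for t'
  proof
    fix g assume "g \<in> cp_image G (dilate (t * t') Q)"
    then obtain h n where h: "h \<in> zero_fibre R" and g: "g = cp_element G Q h n"
        and n: "\<And>i. i < s \<Longrightarrow> \<bar>of_int (n i)\<bar> \<le> (t * t') * dims Q i"
      unfolding mem_cp_image_dilate_iff[OF Q] by auto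
    have "norm (?W n) \<le> real d * (\<kappa> * t')"
      using n box \<kappa>(1) t' by (intro W_norm) auto
    also have "\<dots> \<le> t' / 4"
      using mult_right_mono[OF \<kappa>(2), of t'] t' by (simp add: mult_ac)
    finally show "g \<in> cp_image G (dilate t' P)"
      using from_R[OF t' Q_in_R[OF h]] g by blast
  qed
  \<comment> \<open>Two representations of one element give a relation over \<open>\<one>\<close> of
    norm at most \<open>2 * d * \<kappa>\<close>, which must vanish. The coefficient bound of the
    reduced basis then forces \<open>n = m\<close>, and cancellation gives
    \<open>h = k\<close>.\<close>
  have t_prop: "t_proper G t Q"
    unfolding t_proper_def proper_def
  proof (rule inj_onI, clarify)
    fix h n k m
    assume h: "h \<in> sym_group (dilate t Q)" and k: "k \<in> sym_group (dilate t Q)"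
      and n: "n \<in> coefficient_box (dilate t Q)" and m: "m \<in> coefficient_box (dilate t Q)"
      and "cp_element G (dilate t Q) h n = cp_element G (dilate t Q) k m"
    then have eq: "cp_element G Q h n = cp_element G Q k m" and hk: "h \<in> zero_fibre R" "k \<in> zero_fibre R"
      by simp_all
    have nm: "\<bar>of_int (n i)\<bar> * norm (w i) \<le> \<kappa>" "\<bar>of_int (m i)\<bar> * norm (w i) \<le> \<kappa>" if i: "i < s" for i
    proof -
      have "\<bar>of_int (n i)\<bar> \<le> (t * 1) * dims Q i" "\<bar>of_int (m i)\<bar> \<le> (t * 1) * dims Q i"
        using coefficient_boxD[OF n, of i] coefficient_boxD[OF m, of i] i by simp_all
      then show "\<bar>of_int (n i)\<bar> * norm (w i) \<le> \<kappa>" "\<bar>of_int (m i)\<bar> * norm (w i) \<le> \<kappa>"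
        unfolding box[OF i] by simp_all
    qed
    let ?l = "\<lambda>i. n i - m i"
    have "(?W n - ?W m, cp_element G Q h n \<otimes> inv (cp_element G Q h n)) \<in> R"
      using discrete_relation_diff[OF R Q_in_R[OF hk(1)] Q_in_R[OF hk(2)]] eq by metis
    then have "(?W n - ?W m, \<one>) \<in> R"
      using discrete_relation_carrier[OF R Q_in_R[OF hk(1)]] by simp
    moreover have Wl: "?W n - ?W m = ?W ?l"
      by (simp add: sum_subtractf scaleR_left_diff_distrib)
    ultimately have l: "(?W ?l, \<one>) \<in> R"
      by simp
    have "norm (?W ?l) \<le> real d * (2 * \<kappa>)"
    proof (rule W_norm)
      fix i assume i: "i < s"
      have "\<bar>of_int (?l i)\<bar> * norm (w i) \<le> (\<bar>of_int (n i)\<bar> + \<bar>of_int (m i)\<bar>) * norm (w i)"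
        by (intro mult_right_mono) auto
      also have "\<dots> \<le> 2 * \<kappa>"
        using nm[OF i] by (simp only: distrib_right)
      finally show "\<bar>of_int (?l i)\<bar> * norm (w i) \<le> 2 * \<kappa>" .
    qed (use \<kappa>(1) in simp)
    also have "\<dots> \<le> 1 / (2 * (real d + 1))"
      using \<kappa>(3) by (simp add: mult_ac)
    finally have W0: "?W ?l = 0"
      using no_short[OF l] by (auto simp: d_def)
    have "n i = m i" if i: "i < s" for i
    proof -
      have "\<bar>of_int (?l i)\<bar> * norm (w i) \<le> 0"
        using w_bound[OF i, of ?l] unfolding W0 by simp
      then show ?thesis
        using w0[OF i] by (simp add: mult_le_0_iff)
    qed
    then have nm_eq: "n = m"
      by (intro coefficient_box_eqI[OF n m]) simp
    have "h = k"
    proof -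
      have "h \<in> carrier G" "k \<in> carrier G"
        using hk cp_sym_group_carrier[OF Q] by simp_all
      then show ?thesis
        using eq cp_word_closed[OF Q, of m] unfolding nm_eq cp_element_def by simp
    qed
    with nm_eq show "h = k \<and> n = m"
      by simp
  qed
  \<comment> \<open>Expand the vector \<open>x\<close> over \<open>g\<close> in the basis. The
    quotient of \<open>g\<close> by the corresponding word lies over 0, hence in the symmetry group
    of \<open>Q\<close>; the coefficients are bounded by \<open>w_bound\<close>.\<close>
  have P_sub_Q: "cp_image G (dilate t' P) \<subseteq> cp_image G (dilate (expansion_factor 32 d * t * t') Q)"
    if t': "0 < t'" for t'
  proof
    fix g assume g: "g \<in> cp_image G (dilate t' P)"
    then obtain x where x: "(x, g) \<in> R" "norm x \<le> real d * t'"
      using to_R[OF t'] by (auto simp: d_def)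
    then obtain n where n: "x = ?W n"
      using w_span[of x] by force
    have "(?W n, cp_element G Q \<one> n) \<in> R"
      using Q_in_R discrete_relation_zero[OF R] by (simp add: zero_fibre_def)
    from discrete_relation_diff[OF R x(1) this]
    have h: "g \<otimes> inv (cp_element G Q \<one> n) \<in> zero_fibre R"
      by (simp add: n zero_fibre_def)
    have cl: "g \<in> carrier G" "cp_element G Q \<one> n \<in> carrier G"
      using discrete_relation_carrier[OF R x(1)] cp_element_closed[OF Q] by simp_all
    then have "g = (g \<otimes> inv (cp_element G Q \<one> n)) \<otimes> cp_element G Q \<one> n"
      by (simp add: m_assoc)
    also have "\<dots> = cp_element G Q (g \<otimes> inv (cp_element G Q \<one> n)) n"
      using cp_word_closed[OF Q, of n] cl by (simp add: cp_element_def)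
    finally have g_eq: "g = cp_element G Q (g \<otimes> inv (cp_element G Q \<one> n)) n" .
    have "\<bar>of_int (n i)\<bar> \<le> expansion_factor 32 d * t * t' * dims Q i" if i: "i < s" for i
    proof -
      have "\<bar>of_int (n i)\<bar> * norm (w i) \<le> fact s * norm x"
        using w_bound[OF i, of n] n by simp
      also have "\<dots> \<le> fact s * (real d * t')"
        using x(2) by (intro mult_left_mono) auto
      also have "\<dots> = (fact s * real d * (4 * (real d + 1)\<^sup>2)) * (\<kappa> * t')"
        by (simp add: \<kappa>_def add_nonneg_eq_0_iff)
      also have "\<dots> \<le> expansion_factor 32 d * (\<kappa> * t')"
        using i sd t' \<kappa>(1) by (intro mult_right_mono expansion_factor_ge) auto
      finally have "\<bar>of_int (n i)\<bar> * norm (w i) \<le> \<kappa> * (expansion_factor 32 d * t')"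
        by (simp add: mult_ac)
      then show ?thesis
        using box[OF i, of "n i" "expansion_factor 32 d * t'"] by (simp add: mult_ac)
    qed
    then have "\<forall>i<cp_rank Q. \<bar>of_int (n i)\<bar> \<le> expansion_factor 32 d * t * t' * dims Q i"
      unfolding Q_simps(3) by blast
    moreover have "g \<otimes> inv (cp_element G Q \<one> n) \<in> sym_group Q"
      unfolding Q_simps(4) by (rule h)
    ultimately show "g \<in> cp_image G (dilate (expansion_factor 32 d * t * t') Q)"
      unfolding mem_cp_image_dilate_iff[OF Q] using g_eq by blast
  qed
  have Q_proper: "proper G Q"
    using proper_if_t_proper[OF Q t_prop t] .
  have size_le: "cp_size G Q \<le> cp_size G P"
  proof -
    have "cp_image G (dilate 1 Q) \<subseteq> cp_image G (dilate (t * 1) Q)"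
      using t by (intro cp_image_dilate_mono[OF Q]) simp
    also have "\<dots> \<subseteq> cp_image G (dilate 1 P)"
      by (rule Q_sub_P) simp
    finally show ?thesis
      unfolding cp_size_def using finite_cp_image[OF P] by (intro card_mono) simp_all
  qed
  \<comment> \<open>The image of \<open>P\<close> is covered by the pairs of \<open>R\<close> over
    the ball of radius \<open>d\<close>. These number at most the lattice points in the ball times
    the order of the fibre over 0, and each factor of the lattice count is compared with one side of
    the box of \<open>Q\<close>.\<close>
  have size_ge: "real (cp_size G P) \<le>
      t powr real d * 2 powr ((real d)\<^sup>2 + 32 * real d * ln (real d + 1)) * real (cp_size G Q)"
  proof -
    let ?B = "{z \<in> R. norm (fst z) \<le> real d}"
    let ?a = "2 * real d * (4 * (real d + 1)\<^sup>2) * t"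
    have a: "0 \<le> ?a"
      using t by simp
    have "cp_image G P \<subseteq> snd ` ?B"
    proof
      fix g assume "g \<in> cp_image G P"
      then obtain x where "(x, g) \<in> R" "norm x \<le> real d"
        using to_R[of 1 g] by (auto simp: d_def)
      then show "g \<in> snd ` ?B"
        by force
    qed
    moreover have "finite ?B"
      using R unfolding discrete_relation_def by blast
    ultimately have "cp_size G P \<le> card ?B"
      unfolding cp_size_def by (rule surj_card_le[rotated])
    also have "\<dots> \<le> card {x \<in> fst ` R. norm x \<le> real d} * card (zero_fibre R)"
      by (rule card_relation_ball[OF R])
    finally have "real (cp_size G P) \<le>
        real (card {x \<in> fst ` R. norm x \<le> real d}) * real (card (zero_fibre R))"
      by (simp only: of_nat_le_iff flip: of_nat_mult)
    also have "\<dots> \<le> (2 ^ s\<^sup>2 * (\<Prod>i<s. 1 + 2 * real d / norm (w i))) * real (card (zero_fibre R))"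
      by (intro mult_right_mono w_card) simp_all
    also have "\<dots> \<le> (2 ^ s\<^sup>2 * (\<Prod>i<s. (1 + ?a) * real (2 * nat \<lfloor>dims Q i\<rfloor> + 1))) * real (card (zero_fibre R))"
    proof (intro mult_right_mono mult_left_mono prod_mono conjI)
      fix i assume "i \<in> {..<s}"
      then have i: "i < s" by simp
      \<comment> \<open>\<open>?a\<close> is \<open>2 * d * t / \<kappa>\<close>, which undoes the
        scaling in the dimensions of \<open>Q\<close>.\<close>
      have eq: "2 * real d / norm (w i) = ?a * dims Q i"
        using t by (simp add: \<kappa>_def add_nonneg_eq_0_iff)
      have "0 \<le> dims Q i"
        using \<kappa>(1) t by simp
      from one_add_mult_le_card[OF a this]
      show "1 + 2 * real d / norm (w i) \<le> (1 + ?a) * real (2 * nat \<lfloor>dims Q i\<rfloor> + 1)"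
        unfolding eq .
    qed simp_all
    also have "\<dots> = (2 ^ s\<^sup>2 * (1 + ?a) ^ s) * real (cp_size G Q)"
      unfolding cp_size_proper[OF Q Q_proper]
      by (simp only: prod.distrib prod_constant card_lessThan Q_simps of_nat_mult of_nat_prod mult_ac)
    also have "\<dots> \<le> (t powr real d * 2 powr ((real d)\<^sup>2 + 32 * real d * ln (real d + 1))) * real (cp_size G Q)"
      using size_loss_le[OF sd t] by (intro mult_right_mono) simp_all
    finally show ?thesis .
  qed
  have "t powr (- real d) * 2 powr (- (real d)\<^sup>2 - 32 * real d * ln (real d + 1)) * real (cp_size G P) \<le>
      real (cp_size G Q)"
  proof -
    let ?M = "t powr real d * 2 powr ((real d)\<^sup>2 + 32 * real d * ln (real d + 1))"
    have M: "0 < ?M"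
      using t by simp
    have "- (real d)\<^sup>2 - 32 * real d * ln (real d + 1) = - ((real d)\<^sup>2 + 32 * real d * ln (real d + 1))"
      by simp
    then have "t powr (- real d) * 2 powr (- (real d)\<^sup>2 - 32 * real d * ln (real d + 1)) = 1 / ?M"
      by (simp only: powr_minus_divide) simp
    then show ?thesis
      using size_ge M by (simp add: field_simps)
  qed
  then have "proper_approximation G 32 t P Q"
    unfolding proper_approximation_def
    using Q t_prop sym P_sub_Q Q_sub_P size_le by (auto simp: d_def zero_fibre_def)
  then show ?thesis
    using s by (intro exI[of _ Q]) simp
qed

text \<open>Short relations are removed first. The hypothesis \<open>from_R\<close> for radius
  \<open>t' / 2\<close> leaves room for the cost of lifting, after which radius
  \<open>t' / 4\<close> remains.\<close>

lemma proper_approximation_of_relation: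
  fixes R :: "('e::real_inner \<times> 'a) set" and t :: real
  assumes P: "symmetric_coset_progression G P" and t: "1 \<le> t"
    and R: "discrete_relation G R" and rank: "rank_at_most r (fst ` R)" "r \<le> cp_rank P"
    and sym: "\<And>h. h \<in> sym_group P \<Longrightarrow> (0, h) \<in> R"
    and to_R: "\<And>g t'. 0 < t' \<Longrightarrow> g \<in> cp_image G (dilate t' P) \<Longrightarrow>
        \<exists>x. (x, g) \<in> R \<and> norm x \<le> real (cp_rank P) * t'"
    and from_R: "\<And>x g t'. 1 \<le> t' \<Longrightarrow> (x, g) \<in> R \<Longrightarrow> norm x \<le> t' / 2 \<Longrightarrow> g \<in> cp_image G (dilate t' P)"
  shows "\<exists>Q. proper_approximation G 32 t P Q \<and> cp_rank Q \<le> r"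
proof -
  \<comment> \<open>The threshold of \<open>no_short\<close> in the reduced case, small enough that
    the total squared cost \<open>r * \<delta>\<^sup>2 / 4\<close> is at most 1/16.\<close>
  define \<delta> where "\<delta> = 1 / (2 * (real (cp_rank P) + 1))"
  obtain R' :: "('e \<times> 'a) set" where R': "discrete_relation G R'" "rank_at_most r (fst ` R')"
      and no_short: "\<And>x. (x, \<one>) \<in> R' \<Longrightarrow> x = 0 \<or> \<delta> < norm x"
      and to_R': "\<And>x g. (x, g) \<in> R \<Longrightarrow> \<exists>y. (y, g) \<in> R' \<and> norm y \<le> norm x"
      and from_R': "\<And>y g. (y, g) \<in> R' \<Longrightarrow>
        \<exists>x. (x, g) \<in> R \<and> (norm x)\<^sup>2 \<le> (norm y)\<^sup>2 + real r * \<delta>\<^sup>2 / 4"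
    using eliminate_short_relations[OF R rank(1), of \<delta>] by blast
  have r\<delta>: "real r * \<delta>\<^sup>2 / 4 \<le> 1 / 16"
  proof -
    let ?d = "real (cp_rank P)"
    have "real r * \<delta>\<^sup>2 \<le> (?d + 1) * \<delta>\<^sup>2"
      using rank(2) by (intro mult_right_mono) simp_all
    also have "\<dots> = 1 / (4 * (?d + 1))"
    proof -
      have "u * (1 / (2 * u))\<^sup>2 = 1 / (4 * u)" if "u \<noteq> 0" for u :: real
        using that by (simp add: field_simps power2_eq_square)
      from this[of "?d + 1"] show ?thesis
        unfolding \<delta>_def by (simp add: add_nonneg_eq_0_iff)
    qed
    also have "\<dots> \<le> 1 / 4"
      by simp
    finally show ?thesis
      by simp
  qed
  show ?thesis
  proof (rule proper_approximation_of_reduced_relation[OF P t R' rank(2)])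
    fix h assume "h \<in> sym_group P"
    \<comment> \<open>The forward map does not increase norms, so a pair over 0 goes to a pair over
      0.\<close>
    then show "(0, h) \<in> R'"
      using to_R'[OF sym, of h] by force
  next
    fix g and t' :: real
    assume "0 < t'" "g \<in> cp_image G (dilate t' P)"
    then obtain x where "(x, g) \<in> R" "norm x \<le> real (cp_rank P) * t'"
      using to_R by blast
    then show "\<exists>x. (x, g) \<in> R' \<and> norm x \<le> real (cp_rank P) * t'"
      using to_R'[of x g] by force
  next
    fix y g and t' :: real
    assume t': "1 \<le> t'" and y: "(y, g) \<in> R'" "norm y \<le> t' / 4"
    obtain x where x: "(x, g) \<in> R" "(norm x)\<^sup>2 \<le> (norm y)\<^sup>2 + real r * \<delta>\<^sup>2 / 4"
      using from_R'[OF y(1)] by blast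
    have "(norm y)\<^sup>2 \<le> (t' / 4)\<^sup>2" "1\<^sup>2 \<le> t'\<^sup>2"
      using y(2) t' by (intro power_mono; simp)+
    \<comment> \<open>\<open>t' \<ge> 1\<close> gives
      \<open>t'\<^sup>2 / 16 + 1 / 16 \<le> t'\<^sup>2 / 4\<close>.\<close>
    then have "(norm x)\<^sup>2 \<le> (t' / 2)\<^sup>2"
      using x(2) r\<delta> by (simp add: power_divide)
    then have "norm x \<le> t' / 2"
      by (rule power2_le_imp_le) (use t' in simp)
    then show "g \<in> cp_image G (dilate t' P)"
      using from_R[OF t' x(1)] by blast
  next
    fix x assume "(x, \<one>) \<in> R'" "x \<noteq> 0"
    then show "1 / (2 * (real (cp_rank P) + 1)) < norm x"
      using no_short by (auto simp: \<delta>_def)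
  qed
qed

text \<open>The Euclidean norm dominates each coordinate, so radius \<open>t' / 2\<close> is within
  the dilate by \<open>t'\<close> with a factor 2 to spare.\<close>

lemma ex_proper_approximation:
  assumes P: "symmetric_coset_progression G P" and t: "1 \<le> t"
  shows "\<exists>Q. proper_approximation G 32 t P Q \<and> cp_rank Q \<le> cp_rank P"
proof (rule proper_approximation_of_relation[OF P t discrete_cp_relation[OF P] rank_cp_relation order.refl])
  fix x g and t' :: real
  assume t': "1 \<le> t'" "norm x \<le> t' / 2" "(x, g) \<in> cp_relation P"
  then have "\<bar>coord x i\<bar> \<le> t'" for i
    using abs_coord_le_norm[of x i] by linarith
  then show "g \<in> cp_image G (dilate t' P)"
    using mem_cp_image_of_coord[OF P t'(3)] by blast
qed (use cp_relation_zero[OF P] cp_image_obtain_relation[OF P] in blast)+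

text \<open>Two representations of one element in the dilate by 1/2 have different coefficients,
  since equal ones would force \<open>h = k\<close>. Their difference \<open>b\<close> is a nonzero
  relation with coordinates at most 1. Projecting along it first lowers the rank by one.\<close>

lemma ex_proper_approximation_smaller_rank:
  assumes P: "symmetric_coset_progression G P" and t: "1 \<le> t" and np: "\<not> t_proper G (1/2) P"
  shows "\<exists>Q. proper_approximation G 32 t P Q \<and> cp_rank Q < cp_rank P"
proof -
  let ?D = "dilate (1/2) P"
  obtain h n k m where h: "h \<in> sym_group P" and k: "k \<in> sym_group P"
      and n: "n \<in> coefficient_box ?D" and m: "m \<in> coefficient_box ?D"
      and eq: "cp_element G P h n = cp_element G P k m" and ne: "(h, n) \<noteq> (k, m)"
    using np unfolding t_proper_def proper_def inj_on_def by fastforce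
  have "n \<noteq> m"
  proof
    assume "n = m"
    then have "h = k"
      using eq cp_sym_group_carrier[OF P h] cp_sym_group_carrier[OF P k] cp_word_closed[OF P, of m]
      by (simp add: cp_element_def)
    then show False
      using ne \<open>n = m\<close> by simp
  qed
  then obtain j where j: "j < cp_rank P" "n j \<noteq> m j"
    using coefficient_box_eqI[OF n m] by auto
  define b where "b = cp_embed P n - cp_embed P m"
  have coord_b: "coord b i = of_int (n i - m i) / dims P i" if "i < cp_rank P" for i
    by (simp add: b_def cp_embed_diff coord_cp_embed[OF that])
  have dims: "0 < dims P i" if "i < cp_rank P" for i
    using P that by (simp add: symmetric_coset_progression_def)
  have b0: "b \<noteq> 0"
  proof
    assume "b = 0"
    then show False
      using coord_b[OF j(1)] j(2) dims[OF j(1)] by simp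
  qed
  have b_le: "\<bar>coord b i\<bar> \<le> 1" if i: "i < cp_rank P" for i
  proof -
    have "\<bar>of_int (n i)\<bar> \<le> dims P i / 2" "\<bar>of_int (m i)\<bar> \<le> dims P i / 2"
      using coefficient_boxD[OF n, of i] coefficient_boxD[OF m, of i] i by simp_all
    then show ?thesis
      using dims[OF i] by (simp add: coord_b[OF i] abs_divide)
  qed
  let ?R = "cp_relation P"
  have R: "discrete_relation G ?R"
    by (rule discrete_cp_relation[OF P])
  have "(cp_embed P n, cp_element G P h n) \<in> ?R" "(cp_embed P m, cp_element G P h n) \<in> ?R"
    unfolding cp_relation_def using h k eq by blast+
  from discrete_relation_diff[OF R this] have b: "(b, \<one>) \<in> ?R"
    using cp_element_closed[OF P cp_sym_group_carrier[OF P h]] by (simp add: b_def)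
  then have "b \<in> fst ` ?R"
    by force
  note rank = rank_at_most_proj_away[OF rank_cp_relation this b0]
  have "\<exists>Q. proper_approximation G 32 t P Q \<and> cp_rank Q \<le> cp_rank P - 1"
  proof (rule proper_approximation_of_relation[OF P t discrete_relation_proj[OF R b]])
    show "rank_at_most (cp_rank P - 1) (fst ` proj_relation b ?R)"
      using rank(2) by (simp only: fst_proj_relation)
    show "(0, h) \<in> proj_relation b ?R" if "h \<in> sym_group P" for h
      using proj_relationI[OF cp_relation_zero[OF P that], of b] by simp
    show "\<exists>x. (x, g) \<in> proj_relation b ?R \<and> norm x \<le> real (cp_rank P) * t'"
      if "g \<in> cp_image G (dilate t' P)" for g t'
      using cp_image_obtain_relation[OF P that] proj_relationI norm_proj_away_le order_trans by metis
  next
    fix y g and t' :: real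
    assume t': "1 \<le> t'" and y: "(y, g) \<in> proj_relation b ?R" "norm y \<le> t' / 2"
    obtain x where x: "(x, g) \<in> ?R" "proj_away b x = y" "\<bar>proj_coeff b x\<bar> \<le> 1/2"
      using proj_relation_lift[OF R b y(1)] by blast
    have "\<bar>coord x i\<bar> \<le> t'" if i: "i < cp_rank P" for i
    proof -
      \<comment> \<open>The spare factor 2 is spent here: the projected vector contributes at most
        \<open>t' / 2\<close>, and at most half of \<open>b\<close> contributes
        \<open>1 / 2 \<le> t' / 2\<close>.\<close>
      have "coord x i = coord y i + proj_coeff b x * coord b i"
        using arg_cong[OF proj_away_decomp[of x b], of "\<lambda>z. coord z i"] x(2) by simp
      moreover have "\<bar>coord y i\<bar> \<le> t' / 2"
        using abs_coord_le_norm[of y i] y(2) by linarith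
      moreover have "\<bar>proj_coeff b x * coord b i\<bar> \<le> 1/2 * 1"
        unfolding abs_mult by (intro mult_mono x(3) b_le i) simp_all
      ultimately show ?thesis
        using t' by linarith
    qed
    then show "g \<in> cp_image G (dilate t' P)"
      using mem_cp_image_of_coord[OF P x(1)] by blast
  qed simp
  then show ?thesis
    using rank(1) by fastforce
qed

end

subsection \<open>Passing to a countable group\<close>

text \<open>\<open>P\<close> is the pushforward of \<open>P'\<close> along \<open>\<phi>\<close>. It
  is a relation, not a function, because the steps of a given \<open>P\<close> outside the index
  range are arbitrary.\<close>

definition cp_map :: "('c \<Rightarrow> 'a) \<Rightarrow> 'c coset_progression \<Rightarrow> 'a coset_progression \<Rightarrow> bool" where
  "cp_map \<phi> P' P \<longleftrightarrow> dims P = dims P' \<and> cp_rank P = cp_rank P' \<and>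
     (\<forall>i<cp_rank P'. steps P i = \<phi> (steps P' i)) \<and> sym_group P = \<phi> ` sym_group P'"

lemma cp_map_dilate: "cp_map \<phi> P' P \<Longrightarrow> cp_map \<phi> (dilate t P') (dilate t P)"
  by (simp add: cp_map_def)

locale comm_group_embedding = H: comm_group H + G: comm_group G
  for H :: "('c, 'd) monoid_scheme" and G :: "('a, 'b) monoid_scheme" +
  fixes \<phi> :: "'c \<Rightarrow> 'a"
  assumes hom: "\<phi> \<in> hom H G" and inj: "inj_on \<phi> (carrier H)"
begin

lemma group_hom: "group_hom H G \<phi>"
  by (simp add: group_hom_def group_hom_axioms_def hom H.is_group G.is_group)

lemma cp_map_symmetric_coset_progression:
  assumes P': "symmetric_coset_progression H P'" and PP': "cp_map \<phi> P' P"
  shows "symmetric_coset_progression G P"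
  using P' PP' group_hom.subgroup_img_is_subgroup[OF group_hom] hom_in_carrier[OF hom]
  by (auto simp: symmetric_coset_progression_def cp_map_def)

lemma cp_map_element:
  assumes P': "symmetric_coset_progression H P'" and PP': "cp_map \<phi> P' P" and h: "h \<in> carrier H"
  shows "cp_element G P (\<phi> h) n = \<phi> (cp_element H P' h n)"
proof -
  have st: "steps P' i \<in> carrier H" "\<phi> (steps P' i) \<in> carrier G" if "i < cp_rank P'" for i
    using P' that hom_in_carrier[OF hom] by (auto simp: symmetric_coset_progression_def)
  have "(\<Otimes>\<^bsub>G\<^esub>i\<in>{..<k}. \<phi> (steps P' i) [^]\<^bsub>G\<^esub> n i) = \<phi> (\<Otimes>\<^bsub>H\<^esub>i\<in>{..<k}. steps P' i [^]\<^bsub>H\<^esub> n i)"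
    if "k \<le> cp_rank P'" for k
    using that
  proof (induction k)
    case 0
    then show ?case
      using group_hom.hom_one[OF group_hom] by simp
  next
    case (Suc k)
    have fin: "(\<Otimes>\<^bsub>H\<^esub>i\<in>{..<k}. steps P' i [^]\<^bsub>H\<^esub> n i) \<in> carrier H"
      using Suc.prems st by (intro H.finprod_closed) auto
    have "(\<Otimes>\<^bsub>G\<^esub>i\<in>{..<Suc k}. \<phi> (steps P' i) [^]\<^bsub>G\<^esub> n i) =
        \<phi> (steps P' k) [^]\<^bsub>G\<^esub> n k \<otimes>\<^bsub>G\<^esub> (\<Otimes>\<^bsub>G\<^esub>i\<in>{..<k}. \<phi> (steps P' i) [^]\<^bsub>G\<^esub> n i)"
      unfolding lessThan_Suc using Suc.prems st by (subst G.finprod_insert) auto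
    also have "\<dots> = \<phi> (steps P' k [^]\<^bsub>H\<^esub> n k) \<otimes>\<^bsub>G\<^esub> \<phi> (\<Otimes>\<^bsub>H\<^esub>i\<in>{..<k}. steps P' i [^]\<^bsub>H\<^esub> n i)"
      using Suc st group_hom.hom_int_pow[OF group_hom] by simp
    also have "\<dots> = \<phi> (steps P' k [^]\<^bsub>H\<^esub> n k \<otimes>\<^bsub>H\<^esub> (\<Otimes>\<^bsub>H\<^esub>i\<in>{..<k}. steps P' i [^]\<^bsub>H\<^esub> n i))"
      using Suc.prems st fin by (simp add: hom_mult[OF hom])
    also have "steps P' k [^]\<^bsub>H\<^esub> n k \<otimes>\<^bsub>H\<^esub> (\<Otimes>\<^bsub>H\<^esub>i\<in>{..<k}. steps P' i [^]\<^bsub>H\<^esub> n i) =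
        (\<Otimes>\<^bsub>H\<^esub>i\<in>{..<Suc k}. steps P' i [^]\<^bsub>H\<^esub> n i)"
      unfolding lessThan_Suc using Suc.prems st by (subst H.finprod_insert) auto
    finally show ?case .
  qed
  from this[of "cp_rank P'"]
  have "(\<Otimes>\<^bsub>G\<^esub>i\<in>{..<cp_rank P'}. \<phi> (steps P' i) [^]\<^bsub>G\<^esub> n i) =
      \<phi> (\<Otimes>\<^bsub>H\<^esub>i\<in>{..<cp_rank P'}. steps P' i [^]\<^bsub>H\<^esub> n i)"
    by simp
  moreover have "(\<Otimes>\<^bsub>G\<^esub>i\<in>{..<cp_rank P}. steps P i [^]\<^bsub>G\<^esub> n i) =
      (\<Otimes>\<^bsub>G\<^esub>i\<in>{..<cp_rank P'}. \<phi> (steps P' i) [^]\<^bsub>G\<^esub> n i)"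
    using PP' st by (intro G.finprod_cong') (auto simp: cp_map_def)
  ultimately show ?thesis
    using h H.cp_word_closed[OF P', of n] by (simp add: cp_element_def hom_mult[OF hom])
qed

lemma cp_map_image:
  assumes P': "symmetric_coset_progression H P'" and PP': "cp_map \<phi> P' P"
  shows "cp_image G P = \<phi> ` cp_image H P'"
proof -
  have box: "coefficient_box P = coefficient_box P'" and sg: "sym_group P = \<phi> ` sym_group P'"
    using PP' by (simp_all add: coefficient_box_def cp_map_def)
  have eq: "cp_element G P (\<phi> h) n = \<phi> (cp_element H P' h n)" if "h \<in> sym_group P'" for h n
    using cp_map_element[OF P' PP' H.cp_sym_group_carrier[OF P' that]] .
  show ?thesis
  proof (intro equalityI subsetI)
    fix g assume "g \<in> cp_image G P"
    then obtain h n where "h \<in> sym_group P'" "n \<in> coefficient_box P'" "g = cp_element G P (\<phi> h) n"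
      unfolding cp_image_def box sg by blast
    then show "g \<in> \<phi> ` cp_image H P'"
      unfolding cp_image_def using eq by blast
  next
    fix g assume "g \<in> \<phi> ` cp_image H P'"
    then obtain h n where hn: "h \<in> sym_group P'" "n \<in> coefficient_box P'" "g = \<phi> (cp_element H P' h n)"
      unfolding cp_image_def by blast
    then have "g = cp_element G P (\<phi> h) n"
      using eq by simp
    then show "g \<in> cp_image G P"
      unfolding cp_image_def box sg using hn by blast
  qed
qed

lemma cp_map_size:
  assumes P': "symmetric_coset_progression H P'" and PP': "cp_map \<phi> P' P"
  shows "cp_size G P = cp_size H P'"
proof -
  have "cp_image H P' \<subseteq> carrier H"
    using H.cp_element_closed[OF P' H.cp_sym_group_carrier[OF P']] by (auto simp: cp_image_def)
  then show ?thesis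
    unfolding cp_size_def cp_map_image[OF assms] using inj by (intro card_image) (rule inj_on_subset)
qed

lemma cp_map_proper:
  assumes P': "symmetric_coset_progression H P'" and PP': "cp_map \<phi> P' P" and "proper H P'"
  shows "proper G P"
  unfolding proper_def
proof (rule inj_onI, clarify)
  fix h n k m
  assume "h \<in> sym_group P" "n \<in> coefficient_box P" "k \<in> sym_group P" "m \<in> coefficient_box P"
    and eq: "cp_element G P h n = cp_element G P k m"
  then obtain h' k' where h': "h' \<in> sym_group P'" "h = \<phi> h'" and k': "k' \<in> sym_group P'" "k = \<phi> k'"
      and nm: "n \<in> coefficient_box P'" "m \<in> coefficient_box P'"
    using PP' by (auto simp: coefficient_box_def cp_map_def)
  have hk: "h' \<in> carrier H" "k' \<in> carrier H"
    using H.cp_sym_group_carrier[OF P'] h' k' by auto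
  have "\<phi> (cp_element H P' h' n) = \<phi> (cp_element H P' k' m)"
    using eq cp_map_element[OF P' PP'] h' k' hk by simp
  then have "cp_element H P' h' n = cp_element H P' k' m"
    using inj_onD[OF inj] H.cp_element_closed[OF P'] hk by blast
  then have "(h', n) = (k', m)"
    using inj_onD[OF assms(3)[unfolded proper_def], of "(h', n)" "(k', m)"] h' k' nm by auto
  then show "h = k \<and> n = m"
    using h' k' by simp
qed

text \<open>Push \<open>Q'\<close> forward along \<open>\<phi>\<close>. Images of dilates are mapped
  by \<open>\<phi>\<close>, so inclusions persist; injectivity preserves properness and
  cardinalities.\<close>

lemma cp_map_proper_approximation:
  assumes C: "0 < C" and t: "0 < t" and P': "symmetric_coset_progression H P'" and PP': "cp_map \<phi> P' P"
    and Q': "proper_approximation H C t P' Q'"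
  shows "\<exists>Q. cp_rank Q = cp_rank Q' \<and> proper_approximation G C t P Q"
proof -
  define Q where "Q = \<lparr>dims = dims Q', steps = \<phi> \<circ> steps Q', cp_rank = cp_rank Q', sym_group = \<phi> ` sym_group Q'\<rparr>"
  have QQ': "cp_map \<phi> Q' Q"
    by (simp add: cp_map_def Q_def)
  have Q'_scp: "symmetric_coset_progression H Q'"
    using Q' by (simp add: proper_approximation_def)
  have P_img: "cp_image G (dilate s P) = \<phi> ` cp_image H (dilate s P')" if "0 < s" for s
    using cp_map_image[OF symmetric_coset_progression_dilate[OF P' that] cp_map_dilate[OF PP']] .
  have Q_img: "cp_image G (dilate s Q) = \<phi> ` cp_image H (dilate s Q')" if "0 < s" for s
    using cp_map_image[OF symmetric_coset_progression_dilate[OF Q'_scp that] cp_map_dilate[OF QQ']] .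
  have rank: "cp_rank P = cp_rank P'"
    using PP' by (simp add: cp_map_def)
  have "t_proper G t Q"
    using cp_map_proper[OF symmetric_coset_progression_dilate[OF Q'_scp t] cp_map_dilate[OF QQ']] Q'
    by (simp add: proper_approximation_def t_proper_def)
  moreover have "sym_group P \<subseteq> sym_group Q"
    using Q' PP' by (auto simp: Q_def proper_approximation_def cp_map_def)
  moreover have "cp_image G (dilate t' P) \<subseteq>
      cp_image G (dilate (expansion_factor C (cp_rank P) * t * t') Q)" if t': "0 < t'" for t'
  proof -
    \<comment> \<open>Dilates remain coset progressions only for positive factors, which is where
      \<open>C > 0\<close> enters.\<close>
    have "0 < expansion_factor C (cp_rank P) * t * t'"
      using C t t' by (simp add: expansion_factor_def)
    then show ?thesis
      using Q' t' P_img Q_img rank by (auto simp: proper_approximation_def intro!: image_mono)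
  qed
  moreover have "cp_image G (dilate (t * t') Q) \<subseteq> cp_image G (dilate t' P)" if t': "1 \<le> t'" for t'
    using Q' t t' P_img Q_img by (auto simp: proper_approximation_def intro!: image_mono)
  ultimately have "proper_approximation G C t P Q"
    using Q' cp_map_symmetric_coset_progression[OF Q'_scp QQ']
      cp_map_size[OF P' PP'] cp_map_size[OF Q'_scp QQ']
    by (simp add: proper_approximation_def rank)
  then show ?thesis
    by (intro exI[of _ Q]) (simp add: Q_def)
qed

end

text \<open>The elements with unrestricted coefficients form the subgroup \<open>K\<close> generated
  by the symmetry group and the steps. It is countable, so its structure can be carried over to a
  set of natural numbers.\<close>

lemma (in comm_group) countable_model:
  assumes P: "symmetric_coset_progression G P"
  obtains H :: "nat monoid" and \<phi> P' where
    "comm_group_embedding H G \<phi>" "symmetric_coset_progression H P'" "cp_map \<phi> P' P"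
proof -
  define K where "K = (\<lambda>(h, n). cp_element G P h n) ` (sym_group P \<times> UNIV)"
  have sub: "subgroup (sym_group P) G" and fin: "finite (sym_group P)"
    using P by (simp_all add: symmetric_coset_progression_def)
  have KI: "cp_element G P h n \<in> K" if "h \<in> sym_group P" for h n
    using that by (auto simp: K_def)
  have KE: "\<exists>h n. h \<in> sym_group P \<and> x = cp_element G P h n" if "x \<in> K" for x
    using that by (auto simp: K_def)
  \<comment> \<open>There are uncountably many functions from \<open>nat\<close> to
    \<open>int\<close>, but only the first \<open>cp_rank P\<close> values matter, and lists record
    them.\<close>
  have "K \<subseteq> (\<lambda>(h, xs). cp_element G P h (\<lambda>i. xs ! i)) ` (sym_group P \<times> (UNIV :: int list set))"
  proof
    fix x assume "x \<in> K"
    then obtain h n where hn: "h \<in> sym_group P" "x = cp_element G P h n"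
      using KE by blast
    then have "x = cp_element G P h (\<lambda>i. map n [0..<cp_rank P] ! i)"
      unfolding hn(2) by (intro cp_element_cong[OF P]) simp
    then show "x \<in> (\<lambda>(h, xs). cp_element G P h (\<lambda>i. xs ! i)) ` (sym_group P \<times> UNIV)"
      using hn(1) by (intro image_eqI[of _ _ "(h, map n [0..<cp_rank P])"]) simp_all
  qed
  then have countable: "countable K"
    by (rule countable_subset) (simp add: countable_finite[OF fin])
  have K: "subgroup K G"
  proof
    show "K \<subseteq> carrier G"
    proof
      fix x assume "x \<in> K"
      then obtain h n where "h \<in> sym_group P" "x = cp_element G P h n"
        using KE by blast
      then show "x \<in> carrier G"
        using cp_element_closed[OF P cp_sym_group_carrier[OF P]] by simp
    qed
    show "x \<otimes> y \<in> K" if xy: "x \<in> K" "y \<in> K" for x y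
    proof -
      obtain h n where "h \<in> sym_group P" "x = cp_element G P h n"
        using KE[OF xy(1)] by blast
      moreover obtain k m where "k \<in> sym_group P" "y = cp_element G P k m"
        using KE[OF xy(2)] by blast
      ultimately show ?thesis
        using cp_element_mult[OF P] cp_sym_group_carrier[OF P] KI subgroup.m_closed[OF sub] by simp
    qed
    show "\<one> \<in> K"
      using KI[OF subgroup.one_closed[OF sub], of "\<lambda>_. 0"] by (simp add: cp_element_zero)
    show "inv x \<in> K" if "x \<in> K" for x
    proof -
      obtain h n where "h \<in> sym_group P" "x = cp_element G P h n"
        using KE[OF \<open>x \<in> K\<close>] by blast
      then show ?thesis
        using cp_element_inv[OF P] cp_sym_group_carrier[OF P] KI subgroup.m_inv_closed[OF sub] by simp
    qed
  qed
  have sym_K: "sym_group P \<subseteq> K"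
  proof
    fix h assume h: "h \<in> sym_group P"
    then show "h \<in> K"
      using KI[OF h, of "\<lambda>_. 0"] cp_sym_group_carrier[OF P h] by (simp add: cp_element_zero)
  qed
  have steps_K: "steps P i \<in> K" if i: "i < cp_rank P" for i
  proof -
    have st: "steps P j \<in> carrier G" if "j < cp_rank P" for j
      using P that by (simp add: symmetric_coset_progression_def)
    have "(\<Otimes>j\<in>{..<cp_rank P}. steps P j [^] (if j = i then 1 else 0 :: int)) =
        (\<Otimes>j\<in>{..<cp_rank P}. if i = j then steps P j else \<one>)"
      using st by (intro finprod_cong') auto
    also have "\<dots> = steps P i"
      using st i by (intro finprod_singleton) auto
    finally have "cp_element G P \<one> (\<lambda>j. if j = i then 1 else 0) = steps P i"
      using st[OF i] by (simp add: cp_element_def)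
    then show ?thesis
      using KI[OF subgroup.one_closed[OF sub]] by metis
  qed
  \<comment> \<open>The enumeration \<open>e\<close> transports the operation of \<open>K\<close> to
    \<open>H\<close>; its inverse \<open>\<phi>\<close> is the embedding into
    \<open>G\<close>.\<close>
  define e where "e = to_nat_on K"
  define \<phi> where "\<phi> = inv_into K e"
  have e_inj: "inj_on e K"
    unfolding e_def by (rule inj_on_to_nat_on[OF countable])
  have \<phi>_e: "\<phi> (e x) = x" if "x \<in> K" for x
    unfolding \<phi>_def using e_inj that by simp
  let ?K = "G\<lparr>carrier := K\<rparr>"
  define H :: "nat monoid" where
    "H = \<lparr>carrier = e ` K, monoid.mult = (\<lambda>x y. e (\<phi> x \<otimes> \<phi> y)), one = e \<one>\<rparr>"
  have K_group: "group ?K"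
    by (rule subgroup.subgroup_is_group[OF K is_group])
  have K_comm: "comm_group ?K"
    using subgroup.mem_carrier[OF K] m_comm by (intro group.group_comm_groupI[OF K_group]) simp
  have iso: "e \<in> iso ?K H"
    using e_inj \<phi>_e by (auto simp: iso_def hom_def H_def bij_betw_def)
  have H: "comm_group H"
    using comm_group.iso_imp_img_comm_group[OF K_comm iso] by (simp add: H_def)
  have "\<phi> \<in> iso H ?K"
    using group.iso_set_sym[OF K_group iso] by (simp add: \<phi>_def)
  then have hom: "\<phi> \<in> hom H G" and inj: "inj_on \<phi> (carrier H)"
    using subgroup.mem_carrier[OF K] by (auto simp: iso_def hom_def bij_betw_def)
  define P' where "P' = \<lparr>dims = dims P, steps = e \<circ> steps P, cp_rank = cp_rank P, sym_group = e ` sym_group P\<rparr>"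
  have "group_hom ?K H e"
    using K_group H iso by (simp add: group_hom_def group_hom_axioms_def comm_group_def iso_def)
  then have "subgroup (e ` sym_group P) H"
    using group_hom.subgroup_img_is_subgroup subgroup_incl[OF sub K sym_K] by blast
  then have "symmetric_coset_progression H P'"
    using P fin steps_K by (auto simp: symmetric_coset_progression_def P'_def H_def)
  moreover have "cp_map \<phi> P' P"
  proof -
    have "\<phi> ` e ` sym_group P = sym_group P"
      using sym_K \<phi>_e by (force simp: image_image)
    then show ?thesis
      using steps_K \<phi>_e by (simp add: cp_map_def P'_def)
  qed
  moreover have "comm_group_embedding H G \<phi>"
    using H comm_group_axioms hom inj
    by (simp add: comm_group_embedding_def comm_group_embedding_axioms_def)
  ultimately show ?thesis
    using that by blast
qed

text \<open>\<open>absolute_constant\<close> is a choice about which only its defining property can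
  be known. The witness 32 shows that the property is satisfiable.\<close>

lemma absolute_constant_properties:
  "absolute_constant > 0 \<and>
    (\<forall>(G :: nat monoid) P t.
        comm_group G \<and> symmetric_coset_progression G P \<and> t \<ge> 1 \<longrightarrow>
        (\<exists>Q. proper_approximation G absolute_constant t P Q \<and> cp_rank Q \<le> cp_rank P) \<and>
        (\<not> t_proper G (1/2) P \<longrightarrow>
           (\<exists>Q. proper_approximation G absolute_constant t P Q \<and> cp_rank Q < cp_rank P)))"
  unfolding absolute_constant_def
proof (rule someI[of _ 32], intro conjI allI impI)
  fix G :: "nat monoid" and P and t :: real
  assume "comm_group G \<and> symmetric_coset_progression G P \<and> t \<ge> 1"
  then show "\<exists>Q. proper_approximation G 32 t P Q \<and> cp_rank Q \<le> cp_rank P"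
    using comm_group.ex_proper_approximation by blast
next
  fix G :: "nat monoid" and P and t :: real
  assume "comm_group G \<and> symmetric_coset_progression G P \<and> t \<ge> 1" "\<not> t_proper G (1/2) P"
  then show "\<exists>Q. proper_approximation G 32 t P Q \<and> cp_rank Q < cp_rank P"
    using comm_group.ex_proper_approximation_smaller_rank by blast
qed simp

text \<open>The case \<open>t' = 1\<close>, where \<open>t \<ge> 1\<close> puts the image of
  \<open>Q\<close> inside that of its dilate by \<open>t\<close>.\<close>

lemma (in comm_group) proper_approximation_image:
  assumes t: "1 \<le> t" and "proper_approximation G C t P Q"
  shows "cp_image G Q \<subseteq> cp_image G P"
    "cp_image G P \<subseteq> cp_image G (dilate (expansion_factor C (cp_rank P) * t) Q)"
proof -
  have Q: "symmetric_coset_progression G Q"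
      and 1: "\<And>t'. 0 < t' \<Longrightarrow> cp_image G (dilate t' P) \<subseteq>
        cp_image G (dilate (expansion_factor C (cp_rank P) * t * t') Q)"
      and 2: "\<And>t'. 1 \<le> t' \<Longrightarrow> cp_image G (dilate (t * t') Q) \<subseteq> cp_image G (dilate t' P)"
    using assms(2) by (auto simp only: proper_approximation_def)
  show "cp_image G Q \<subseteq> cp_image G P"
    using cp_image_dilate_mono[OF Q t] 2[of 1] by simp
  show "cp_image G P \<subseteq> cp_image G (dilate (expansion_factor C (cp_rank P) * t) Q)"
    using 1[of 1] by simp
qed

theorem theorem1p17:
  fixes G :: "('a, 'b) monoid_scheme"
  assumes "comm_group G"
  shows "absolute_constant > 0 \<and>
    (\<forall>P t. symmetric_coset_progression G P \<and> t \<ge> 1 \<longrightarrow>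
      (\<exists>Q. proper_approximation G absolute_constant t P Q \<and>
           cp_rank Q \<le> cp_rank P \<and>
           cp_image G Q \<subseteq> cp_image G P \<and>
           cp_image G P \<subseteq>
             cp_image G (dilate (expansion_factor absolute_constant (cp_rank P) * t) Q)) \<and>
      (\<not> t_proper G (1/2) P \<longrightarrow>
        (\<exists>Q. proper_approximation G absolute_constant t P Q \<and> cp_rank Q < cp_rank P)))"
proof (intro conjI allI impI)
  show C: "absolute_constant > 0"
    using absolute_constant_properties by blast
  interpret comm_group G by fact
  fix P and t :: real
  assume Pt: "symmetric_coset_progression G P \<and> t \<ge> 1"
  then have P: "symmetric_coset_progression G P" and t: "1 \<le> t" "0 < t"
    by auto
  \<comment> \<open>The chosen constant is only known to work over \<open>nat\<close>, so it is
    applied to a countable model and the result is pushed forward to \<open>G\<close>.\<close>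
  obtain H :: "nat monoid" and \<phi> P' where emb: "comm_group_embedding H G \<phi>"
      and P': "symmetric_coset_progression H P'" and PP': "cp_map \<phi> P' P"
    using countable_model[OF P] by blast
  interpret E: comm_group_embedding H G \<phi> by (rule emb)
  have rank: "cp_rank P = cp_rank P'"
    using PP' by (simp add: cp_map_def)
  have nat_case: "\<exists>Q. proper_approximation H absolute_constant t P' Q \<and> cp_rank Q \<le> cp_rank P'"
      "\<not> t_proper H (1/2) P' \<Longrightarrow> \<exists>Q. proper_approximation H absolute_constant t P' Q \<and> cp_rank Q < cp_rank P'"
    using absolute_constant_properties E.H.comm_group_axioms P' t(1) by blast+
  obtain Q where Q: "proper_approximation G absolute_constant t P Q" "cp_rank Q \<le> cp_rank P"
    using nat_case(1) E.cp_map_proper_approximation[OF C t(2) P' PP'] rank by metis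
  then show "\<exists>Q. proper_approximation G absolute_constant t P Q \<and>
           cp_rank Q \<le> cp_rank P \<and>
           cp_image G Q \<subseteq> cp_image G P \<and>
           cp_image G P \<subseteq>
             cp_image G (dilate (expansion_factor absolute_constant (cp_rank P) * t) Q)"
    using proper_approximation_image[OF t(1) Q(1)] by blast
  assume "\<not> t_proper G (1/2) P"
  \<comment> \<open>Contrapositive: properness of the dilate by 1/2 of \<open>P'\<close> would pass
    to \<open>P\<close> along the injective \<open>\<phi>\<close>.\<close>
  then have "\<not> t_proper H (1/2) P'"
    using E.cp_map_proper[OF symmetric_coset_progression_dilate[OF P'] cp_map_dilate[OF PP'], of "1/2"]
    by (auto simp: t_proper_def)
  then show "\<exists>Q. proper_approximation G absolute_constant t P Q \<and> cp_rank Q < cp_rank P"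
    using nat_case(2) E.cp_map_proper_approximation[OF C t(2) P' PP'] rank by metis
qed

end
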